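(* Let $1\le r\le n$, let $p=(p_1,\dots,p_n)$ be a size vector with $p_1\le p_2\le\cdots\le p_n$, and let $A,B\subseteq S_p$ be an $r$-cross-intersecting pair of families. (1) If $p_1>r+1$, then $|A|\cdot|B|\le\prod_{i=r+1}^n p_i^2$; in case of equality $A=B$ and this family is obtained by fixing $r$ coordinates (i.e. it equals $\{x\in S_p: x_i=a_i \text{ for all } i\in R\}$ for some $R\subseteq[n]$ with $|R|=r$ and some $a_i\in[p_i]$). (2) If $p_1=r+1>4$, then $|A|\cdot|B|\le\prod_{i=r+1}^n p_i^2$; in case of equality $A=B$ and this family is either obtained by fixing $r$ coordinates, or is a Hamming ball of radius $1$ in a set $T$ of $r+2$ coordinates all satisfying $p_i=r+1$ ($i\in T$). (3) There is a function $t$ with $t(r)=r/2+o(r)$ such that if $p_1\ge t(r)$ and $(A,B)$ is a maximal $r$-cross-intersecting pair, then $A$ and $B$ are Hamming balls in some set of at most $r+3$ coordinates.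
   Context: $[m]=\{1,\dots,m\}$. A size vector is a sequence of integers $p=(p_1,\dots,p_n)$ with $p_i\ge 2$ for all $i$; $S_p=[p_1]\times\cdots\times[p_n]$. Two vectors $x,y\in S_p$ are $r$-intersecting if $|\{i: x_i=y_i\}|\ge r$; families $A,B\subseteq S_p$ are $r$-cross-intersecting if every $x\in A$, $y\in B$ are $r$-intersecting. A pair $(A,B)$ of $r$-cross-intersecting families in $S_p$ is maximal if it maximizes $|A|\cdot|B|$ among all $r$-cross-intersecting pairs in $S_p$. For $T\subseteq[n]$, $x_0\in S_p$ and $0\le k\le|T|$, the Hamming ball of radius $k$ around $x_0$ in the coordinates $T$ is $\{x\in S_p: |\{i\in T: x_i\ne (x_0)_i\}|\le k\}$. *)

theory Defs
  imports Main "HOL-Library.FuncSet" "HOL-Library.Landau_Symbols"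
begin

definition size_vector :: "nat \<Rightarrow> (nat \<Rightarrow> nat) \<Rightarrow> bool" where
  "size_vector n p \<longleftrightarrow> (\<forall>i\<in>{1..n}. 2 \<le> p i)"

definition Sp :: "nat \<Rightarrow> (nat \<Rightarrow> nat) \<Rightarrow> (nat \<Rightarrow> nat) set" where
  "Sp n p = PiE {1..n} (\<lambda>i. {1..p i})"

definition r_intersecting :: "nat \<Rightarrow> nat \<Rightarrow> (nat \<Rightarrow> nat) \<Rightarrow> (nat \<Rightarrow> nat) \<Rightarrow> bool" where
  "r_intersecting n r x y \<longleftrightarrow> r \<le> card {i\<in>{1..n}. x i = y i}"

definition cross_intersecting ::
  "nat \<Rightarrow> (nat \<Rightarrow> nat) \<Rightarrow> nat \<Rightarrow> (nat \<Rightarrow> nat) set \<Rightarrow> (nat \<Rightarrow> nat) set \<Rightarrow> bool" where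
  "cross_intersecting n p r A B \<longleftrightarrow>
     A \<subseteq> Sp n p \<and> B \<subseteq> Sp n p \<and> (\<forall>x\<in>A. \<forall>y\<in>B. r_intersecting n r x y)"

definition maximal_pair ::
  "nat \<Rightarrow> (nat \<Rightarrow> nat) \<Rightarrow> nat \<Rightarrow> (nat \<Rightarrow> nat) set \<Rightarrow> (nat \<Rightarrow> nat) set \<Rightarrow> bool" where
  "maximal_pair n p r A B \<longleftrightarrow> cross_intersecting n p r A B \<and>
     (\<forall>A' B'. cross_intersecting n p r A' B' \<longrightarrow> card A' * card B' \<le> card A * card B)"

definition hamming_ball ::
  "nat \<Rightarrow> (nat \<Rightarrow> nat) \<Rightarrow> nat set \<Rightarrow> (nat \<Rightarrow> nat) \<Rightarrow> nat \<Rightarrow> (nat \<Rightarrow> nat) set" where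
  "hamming_ball n p T x0 k = {x \<in> Sp n p. card {i\<in>T. x i \<noteq> x0 i} \<le> k}"

definition fixes_r_coords ::
  "nat \<Rightarrow> (nat \<Rightarrow> nat) \<Rightarrow> nat \<Rightarrow> (nat \<Rightarrow> nat) set \<Rightarrow> bool" where
  "fixes_r_coords n p r F \<longleftrightarrow> (\<exists>R a. R \<subseteq> {1..n} \<and> card R = r \<and> (\<forall>i\<in>R. a i \<in> {1..p i}) \<and>
      F = {x \<in> Sp n p. \<forall>i\<in>R. x i = a i})"

definition sorted_sizes :: "nat \<Rightarrow> (nat \<Rightarrow> nat) \<Rightarrow> bool" where
  "sorted_sizes n p \<longleftrightarrow> (\<forall>i j. 1 \<le> i \<longrightarrow> i \<le> j \<longrightarrow> j \<le> n \<longrightarrow> p i \<le> p j)"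

end

(*
Pass to a maximal pair (A, B) and forget the coordinates on which A (equivalently B) does not
depend; say m = r + s coordinates are left. For such a coordinate i with p_i >= 3, gluing a fibre of A
to the union of the other fibres of B gives competing pairs. With alpha, beta the frequencies of
x_i = v in A and B and c = 1/p_i, maximality yields alpha (1 - beta) <= c (1 - c) and
beta (1 - alpha) <= c (1 - c), so both frequencies are <= c or both are >= 1 - c. Not all values can be
rare, hence some value z_i is taken with frequency at least 1 - 1/p_i in both A and B.

The entropy of such a coordinate is smaller than ln p_i by at least (1 - 2/p_i) ln (p_i - 1), so
subadditivity of entropy, compared with the family fixing r of the coordinates, gives s <= 3
in all three cases. As z_i is so frequent, every x in A and y in B differs from z in at most s places.
If x differs from z in a places and y in b places, most elements of B avoid the a places, so B is nearly
contained in a ball of radius s - a, and A in one of radius s - b. For a + b > s the product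
|A||B| would be too small, so a + b <= s throughout and A, B are complementary balls around z.
In cases (1) and (2) the frequency bound excludes radii >= 2, and comparison with the fixed-coordinate
families settles the remaining radii.
*)
theory Submission
  imports Defs "HOL-Real_Asymp.Real_Asymp"
begin

section \<open>Maximal cross-agreeing pairs\<close>

text \<open>Write P for the least size. To leading order the entropy comparison reads s ln P <= r (2
  ln P) / P, so s is at most about 2r/P. Hence P > r/2 keeps s below 4, the common origin of t(r) =
  r/2 + o(r) and of r + 3. Lower order terms decide the small cases: for r = 3, P = 4 the comparison
  does not exclude s = 4, which is where the method needs r + 1 > 4. Sizes above P are arbitrary, so
  no absolute bound on |A||B| is at hand when a + b > s is refuted. Everything is measured against
  X, the largest product of s sizes: fixing the other r coordinates shows X^2 <= |A||B|, while balls
  are bounded by X times a quantity in m, s, P alone, so X cancels. Bounding |B| through a ball of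
  radius s - a costs a factor P / (P - a), which is worthless for a = P = 3. In the three cases this
  arises only for r = 1, s = 3. Then all four sizes are forced to be 3, and this configuration is
  settled by explicit counting.\<close>

definition cube :: "'i set \<Rightarrow> ('i \<Rightarrow> nat) \<Rightarrow> ('i \<Rightarrow> nat) set" where
  "cube I p = PiE I (\<lambda>i. {1..p i})"

text \<open>The index set is arbitrary rather than \<open>{1..n}\<close> because irrelevant
  coordinates are deleted anywhere and the pair is then studied on what remains.\<close>

definition cross_agree ::
  "'i set \<Rightarrow> ('i \<Rightarrow> nat) \<Rightarrow> nat \<Rightarrow> ('i \<Rightarrow> nat) set \<Rightarrow> ('i \<Rightarrow> nat) set \<Rightarrow> bool" where
  "cross_agree I p r A B \<longleftrightarrow> A \<subseteq> cube I p \<and> B \<subseteq> cube I p \<and>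
     (\<forall>x\<in>A. \<forall>y\<in>B. r \<le> card {i\<in>I. x i = y i})"

definition max_cross ::
  "'i set \<Rightarrow> ('i \<Rightarrow> nat) \<Rightarrow> nat \<Rightarrow> ('i \<Rightarrow> nat) set \<Rightarrow> ('i \<Rightarrow> nat) set \<Rightarrow> bool" where
  "max_cross I p r A B \<longleftrightarrow> cross_agree I p r A B \<and>
     (\<forall>A' B'. cross_agree I p r A' B' \<longrightarrow> card A' * card B' \<le> card A * card B)"

definition irrelevant :: "('i \<Rightarrow> nat) \<Rightarrow> ('i \<Rightarrow> nat) set \<Rightarrow> 'i \<Rightarrow> bool" where
  "irrelevant p A i \<longleftrightarrow> (\<forall>x\<in>A. \<forall>v\<in>{1..p i}. x(i := v) \<in> A)"

lemma finite_cube: "finite I \<Longrightarrow> finite (cube I p)"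
  unfolding cube_def by (auto intro: finite_PiE)

lemma cube_mem: "x \<in> cube I p \<Longrightarrow> i \<in> I \<Longrightarrow> x i \<in> {1..p i}"
  unfolding cube_def by (auto dest: PiE_mem)

lemma cube_upd: "x \<in> cube I p \<Longrightarrow> i \<in> I \<Longrightarrow> v \<in> {1..p i} \<Longrightarrow> x(i := v) \<in> cube I p"
  unfolding cube_def by (auto simp: PiE_iff extensional_def)

lemma cube_eqI:
  "x \<in> cube I p \<Longrightarrow> y \<in> cube I p \<Longrightarrow> (\<And>i. i \<in> I \<Longrightarrow> x i = y i) \<Longrightarrow> x = y"
  unfolding cube_def by (rule PiE_ext)

lemma cross_agree_sym: "cross_agree I p r A B \<Longrightarrow> cross_agree I p r B A"
  unfolding cross_agree_def by (metis (mono_tags, lifting) Collect_cong)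

lemma max_cross_sym: "max_cross I p r A B \<Longrightarrow> max_cross I p r B A"
  unfolding max_cross_def using cross_agree_sym by (metis mult.commute)

lemma cross_agree_finite:
  assumes "cross_agree I p r A B" "finite I" shows "finite A" "finite B"
  using assms finite_cube finite_subset unfolding cross_agree_def by metis+

lemma max_cross_exists:
  assumes "finite I" obtains A B where "max_cross I p r A B"
proof -
  define F where "F = {(A, B). cross_agree I p r A B}"
  have "F \<subseteq> Pow (cube I p) \<times> Pow (cube I p)" unfolding F_def cross_agree_def by auto
  then have fin: "finite F" using finite_cube[OF assms] by (meson finite_Pow_iff finite_SigmaI finite_subset)
  have ne: "({}, {}) \<in> F" unfolding F_def cross_agree_def by auto
  define f :: "('a \<Rightarrow> nat) set \<times> ('a \<Rightarrow> nat) set \<Rightarrow> nat"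
    where "f = (\<lambda>(A, B). card A * card B)"
  have "Max (f ` F) \<in> f ` F" using fin ne by (intro Max_in) auto
  then obtain C where C: "C \<in> F" "f C = Max (f ` F)" by auto
  have "f D \<le> f C" if "D \<in> F" for D unfolding C(2) using that fin by auto
  then have "max_cross I p r (fst C) (snd C)"
    using C(1) unfolding max_cross_def F_def f_def by (auto simp: case_prod_beta)
  then show ?thesis using that by blast
qed

lemma card_subcube:
  assumes "finite I" "R \<subseteq> I" "\<forall>i\<in>R. a i \<in> {1..p i}"
  shows "card {x \<in> cube I p. \<forall>i\<in>R. x i = a i} = (\<Prod>i\<in>I - R. p i)"
proof -
  have "{x \<in> cube I p. \<forall>i\<in>R. x i = a i} = PiE I (\<lambda>i. if i \<in> R then {a i} else {1..p i})"
    unfolding cube_def using assms(2,3) by (fastforce simp: PiE_iff split: if_splits)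
  then have "card {x \<in> cube I p. \<forall>i\<in>R. x i = a i} = (\<Prod>i\<in>I. if i \<in> R then 1 else p i)"
    using assms(1) by (simp add: card_PiE if_distrib cong: if_cong)
  also have "\<dots> = (\<Prod>i\<in>I - R. p i)"
    using assms(1,2) by (subst prod.subset_diff[of R]) (auto intro!: prod.cong)
  finally show ?thesis .
qed

text \<open>The competitor is a subcube paired with itself: any two of its members agree on all of
  \<open>R\<close>.\<close>

lemma max_cross_ge:
  assumes "max_cross I p r A B" "finite I" "R \<subseteq> I" "card R = r" "\<forall>i\<in>I. 1 \<le> p i"
  shows "(\<Prod>i\<in>I - R. p i)\<^sup>2 \<le> card A * card B"
proof -
  define F where "F = {x \<in> cube I p. \<forall>i\<in>R. x i = 1}"
  have cF: "card F = (\<Prod>i\<in>I - R. p i)"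
    unfolding F_def using assms by (intro card_subcube) auto
  have "cross_agree I p r F F" unfolding cross_agree_def
  proof (intro conjI ballI)
    fix x y assume "x \<in> F" "y \<in> F"
    then have "R \<subseteq> {i\<in>I. x i = y i}" using assms(3) unfolding F_def by auto
    then show "r \<le> card {i\<in>I. x i = y i}"
      using card_mono[of "{i\<in>I. x i = y i}" R] assms(2,4) by simp
  qed (auto simp: F_def)
  then have "card F * card F \<le> card A * card B" using assms(1) unfolding max_cross_def by blast
  then show ?thesis using cF by (simp add: power2_eq_square)
qed

lemma max_cross_pos:
  assumes "max_cross I p r A B" "finite I" "r \<le> card I" "\<forall>i\<in>I. 1 \<le> p i"
  shows "card A > 0" "card B > 0"
proof -
  obtain R where R: "R \<subseteq> I" "card R = r" using assms(3) obtain_subset_with_card_n by metis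
  have "(\<Prod>i\<in>I - R. p i) > 0" using assms(4) by (intro prod_pos) force
  then have "card A * card B > 0"
    using max_cross_ge[OF assms(1,2) R assms(4)] by (metis not_gr_zero le_zero_eq power_eq_0_iff)
  then show "card A > 0" "card B > 0" by auto
qed

text \<open>Otherwise adding \<open>x\<close> to \<open>A\<close> would enlarge the product, since
  \<open>B\<close> is nonempty. This saturation later turns bounds on supports into whole
  balls.\<close>

lemma max_cross_closed:
  assumes "max_cross I p r A B" "finite I" "r \<le> card I" "\<forall>i\<in>I. 1 \<le> p i"
    and x: "x \<in> cube I p" "\<And>y. y \<in> B \<Longrightarrow> r \<le> card {i\<in>I. x i = y i}"
  shows "x \<in> A"
proof (rule ccontr)
  assume n: "x \<notin> A"
  have cr: "cross_agree I p r A B" using assms(1) unfolding max_cross_def by auto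
  then have "cross_agree I p r (insert x A) B" using x unfolding cross_agree_def by auto
  then have "card (insert x A) * card B \<le> card A * card B"
    using assms(1) unfolding max_cross_def by blast
  then have "card (insert x A) \<le> card A" using max_cross_pos[OF assms(1-4)] by simp
  then show False using n cross_agree_finite[OF cr assms(2)] by simp
qed

text \<open>Given \<open>y\<close> in \<open>B\<close> and \<open>x\<close> in \<open>A\<close>,
  move \<open>x\<close> at \<open>i\<close> to a value other than \<open>y i\<close>. The result is
  still in \<open>A\<close>, so its \<open>r\<close> agreements with \<open>y\<close> all avoid
  \<open>i\<close> and survive any change of \<open>y\<close> at \<open>i\<close>. Saturation puts
  the changed \<open>y\<close> into \<open>B\<close>.\<close>

lemma irrelevant_transfer:
  assumes mx: "max_cross I p r A B" and I: "finite I" "r \<le> card I" "\<forall>i\<in>I. 2 \<le> p i"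
    and i: "i \<in> I" and irr: "irrelevant p A i"
  shows "irrelevant p B i"
  unfolding irrelevant_def
proof (intro ballI)
  fix y v assume y: "y \<in> B" and v: "v \<in> {1..p i}"
  have cr: "cross_agree I p r A B" using mx unfolding max_cross_def by auto
  show "y(i := v) \<in> B"
  proof (rule max_cross_closed[OF max_cross_sym[OF mx] I(1,2)])
    show "\<forall>i\<in>I. 1 \<le> p i" using I by force
    have "y \<in> cube I p" using cr y unfolding cross_agree_def by auto
    then show "y(i := v) \<in> cube I p" using i v by (rule cube_upd)
    fix x assume x: "x \<in> A"
    define w where "w = (if y i = 1 then 2 else 1 :: nat)"
    have "w \<in> {1..p i}" unfolding w_def using bspec[OF I(3) i] by auto
    then have "x(i := w) \<in> A" using irr x unfolding irrelevant_def by blast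
    then have "r \<le> card {j\<in>I. (x(i := w)) j = y j}" using cr y unfolding cross_agree_def by blast
    also have "\<dots> \<le> card {j\<in>I. (y(i := v)) j = x j}"
      by (rule card_mono) (use I in \<open>auto simp: w_def split: if_splits\<close>)
    finally show "r \<le> card {j\<in>I. (y(i := v)) j = x j}" .
  qed
qed

section \<open>Competing pairs from the fibres of one coordinate\<close>

definition lift :: "('i \<Rightarrow> nat) \<Rightarrow> 'i \<Rightarrow> ('i \<Rightarrow> nat) set \<Rightarrow> ('i \<Rightarrow> nat) set" where
  "lift p i C = (\<lambda>(v, x). x(i := v)) ` ({1..p i} \<times> C)"

lemma card_lift:
  assumes "C \<subseteq> cube (I - {i}) p" shows "card (lift p i C) = p i * card C"
proof -
  have "inj_on (\<lambda>(v, x). x(i := v)) ({1..p i} \<times> C)"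
  proof (rule inj_onI, clarify)
    fix v x w y assume "x \<in> C" "y \<in> C" and e: "x(i := v) = y(i := w)"
    then have "x i = undefined" "y i = undefined"
      using assms unfolding cube_def by (auto simp: PiE_iff extensional_def)
    then show "v = w \<and> x = y" using e by (metis fun_upd_same fun_upd_triv fun_upd_upd)
  qed
  then show ?thesis unfolding lift_def by (simp add: card_image card_cartesian_product)
qed

lemma lift_subset:
  assumes "C \<subseteq> cube (I - {i}) p" "i \<in> I" shows "lift p i C \<subseteq> cube I p"
proof
  fix y assume "y \<in> lift p i C"
  then obtain v x where "v \<in> {1..p i}" "x \<in> C" "y = x(i := v)" unfolding lift_def by auto
  then show "y \<in> cube I p"
    using assms unfolding cube_def by (auto simp: PiE_iff extensional_def)
qed

lemma cross_agree_lift: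
  assumes "cross_agree (I - {i}) p r C D" "i \<in> I" "finite I"
  shows "cross_agree I p r (lift p i C) (lift p i D)"
  unfolding cross_agree_def
proof (intro conjI ballI)
  show "lift p i C \<subseteq> cube I p" "lift p i D \<subseteq> cube I p"
    using assms lift_subset unfolding cross_agree_def by metis+
  fix x y assume "x \<in> lift p i C" "y \<in> lift p i D"
  then obtain x' y' v w where e: "x' \<in> C" "y' \<in> D" "x = x'(i := v)" "y = y'(i := w)"
    unfolding lift_def by auto
  then have "r \<le> card {j\<in>I - {i}. x' j = y' j}" using assms(1) unfolding cross_agree_def by blast
  also have "\<dots> \<le> card {j\<in>I. x j = y j}" by (rule card_mono) (use assms(3) e in auto)
  finally show "r \<le> card {j\<in>I. x j = y j}" .
qed

lemma max_cross_lift: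
  assumes "max_cross I p r A B" "cross_agree (I - {i}) p r C D" "i \<in> I" "finite I"
  shows "(p i)\<^sup>2 * (card C * card D) \<le> card A * card B"
proof -
  have "card (lift p i C) * card (lift p i D) \<le> card A * card B"
    using assms(1) cross_agree_lift[OF assms(2-4)] unfolding max_cross_def by blast
  moreover have "card (lift p i C) = p i * card C" "card (lift p i D) = p i * card D"
    using assms(2) card_lift unfolding cross_agree_def by metis+
  ultimately show ?thesis by (simp add: power2_eq_square algebra_simps)
qed

text \<open>Dropping means setting to \<open>undefined\<close>, the value outside the index set in \<open>PiE\<close>.\<close>

definition drop_coord :: "'i \<Rightarrow> nat set \<Rightarrow> ('i \<Rightarrow> nat) set \<Rightarrow> ('i \<Rightarrow> nat) set" where
  "drop_coord i L A = (\<lambda>x. x(i := undefined)) ` {x\<in>A. x i \<in> L}"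

text \<open>As \<open>L\<close> and \<open>M\<close> are disjoint, the two vectors disagree at
  \<open>i\<close>, so deleting \<open>i\<close> costs no agreement. With \<open>L = {v}\<close> and
  \<open>M\<close> the other values, this is the gluing: members of \<open>B\<close> that agree off
  \<open>i\<close> are merged.\<close>

lemma cross_agree_drop:
  assumes "cross_agree I p r A B" "L \<inter> M = {}"
  shows "cross_agree (I - {i}) p r (drop_coord i L A) (drop_coord i M B)"
  unfolding cross_agree_def
proof (intro conjI ballI)
  show "drop_coord i L A \<subseteq> cube (I - {i}) p" "drop_coord i M B \<subseteq> cube (I - {i}) p"
    using assms(1) unfolding cross_agree_def drop_coord_def cube_def
    by (auto simp: PiE_iff extensional_def subset_iff)
  fix x y assume "x \<in> drop_coord i L A" "y \<in> drop_coord i M B"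
  then obtain x' y' where e: "x' \<in> A" "y' \<in> B" "x' i \<in> L" "y' i \<in> M"
    "x = x'(i := undefined)" "y = y'(i := undefined)" unfolding drop_coord_def by auto
  then have "r \<le> card {j\<in>I. x' j = y' j}" using assms(1) unfolding cross_agree_def by blast
  moreover have "{j\<in>I. x' j = y' j} = {j\<in>I - {i}. x j = y j}" using e assms(2) by auto
  ultimately show "r \<le> card {j\<in>I - {i}. x j = y j}" by simp
qed

lemma card_drop_single: "card (drop_coord i {v} A) = card {x\<in>A. x i = v}"
proof -
  have "inj_on (\<lambda>x. x(i := undefined)) {x\<in>A. x i = v}"
    by (rule inj_onI) (auto simp: fun_eq_iff, metis)
  then show ?thesis unfolding drop_coord_def by (simp add: card_image)
qed

text \<open>Each glued vector comes from at most one member per value in \<open>M\<close>.\<close>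

lemma card_le_drop:
  assumes "finite A" "finite M"
  shows "card {x\<in>A. x i \<in> M} \<le> card M * card (drop_coord i M A)"
proof -
  have "{x\<in>A. x i \<in> M} = (\<Union>v\<in>M. {x\<in>A. x i = v})" by auto
  then have "card {x\<in>A. x i \<in> M} \<le> (\<Sum>v\<in>M. card {x\<in>A. x i = v})"
    using assms(2) by (simp add: card_UN_le)
  also have "\<dots> \<le> (\<Sum>v\<in>M. card (drop_coord i M A))"
  proof (rule sum_mono)
    fix v assume "v \<in> M"
    then have "drop_coord i {v} A \<subseteq> drop_coord i M A" unfolding drop_coord_def by auto
    then show "card {x\<in>A. x i = v} \<le> card (drop_coord i M A)"
      unfolding card_drop_single[symmetric] using assms(1)
      by (intro card_mono) (auto simp: drop_coord_def)
  qed
  finally show ?thesis by simp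
qed

text \<open>If one frequency is at most \<open>c\<close>, the inequality containing its complement
  forces the other below \<open>c\<close> as well; the same holds for the complements. If all four
  of \<alpha>, \<beta>, 1 - \<alpha>, 1 - \<beta> exceeded \<open>c\<close>, then \<alpha>(1 -
  \<alpha>) and \<beta>(1 - \<beta>) would both exceed c(1 - c), but their product is also the
  product of the two left sides in the hypotheses.\<close>

lemma dichotomy:
  fixes \<alpha> \<beta> c :: real
  assumes "0 \<le> \<alpha>" "\<alpha> \<le> 1" "0 \<le> \<beta>" "\<beta> \<le> 1" "0 < c" "c < 1"
    and 1: "\<alpha> * (1 - \<beta>) \<le> c * (1 - c)" and 2: "\<beta> * (1 - \<alpha>) \<le> c * (1 - c)"
  shows "\<alpha> \<le> c \<and> \<beta> \<le> c \<or> 1 - \<alpha> \<le> c \<and> 1 - \<beta> \<le> c"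
proof -
  have small: "v \<le> c" if "u \<le> c" "v * (1 - u) \<le> c * (1 - c)" "0 \<le> v" for u v :: real
  proof -
    have "v * (1 - c) \<le> v * (1 - u)" using that by (intro mult_left_mono) auto
    then have "v * (1 - c) \<le> c * (1 - c)" using that(2) by linarith
    then show ?thesis using \<open>c < 1\<close> by simp
  qed
  have big: "False" if "c < \<alpha>" "c < \<beta>" "c < 1 - \<alpha>" "c < 1 - \<beta>"
  proof -
    have a: "c * (1 - c) < \<alpha> * (1 - \<alpha>)"
      using mult_pos_pos[of "\<alpha> - c" "1 - \<alpha> - c"] that by (simp add: algebra_simps)
    have b: "c * (1 - c) < \<beta> * (1 - \<beta>)"
      using mult_pos_pos[of "\<beta> - c" "1 - \<beta> - c"] that by (simp add: algebra_simps)
    have "(c * (1 - c)) * (c * (1 - c)) < (\<alpha> * (1 - \<alpha>)) * (\<beta> * (1 - \<beta>))"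
      using assms(5,6) by (intro mult_strict_mono'[OF a b]) auto
    also have "\<dots> = (\<alpha> * (1 - \<beta>)) * (\<beta> * (1 - \<alpha>))" by (simp add: algebra_simps)
    also have "\<dots> \<le> (c * (1 - c)) * (c * (1 - c))"
      using assms by (intro mult_mono[OF 1 2]) auto
    finally show False by simp
  qed
  show ?thesis
    using small[of \<alpha> \<beta>] small[of \<beta> \<alpha>] small[of "1 - \<alpha>" "1 - \<beta>"] small[of "1 - \<beta>" "1 - \<alpha>"]
      big assms by (smt (verit) mult.commute)
qed

lemma max_cross_disjoint:
  assumes "max_cross I p r A B" "finite I" "i \<in> I" "L \<inter> M = {}"
  shows "(p i)\<^sup>2 * (card (drop_coord i L A) * card (drop_coord i M B)) \<le> card A * card B"
proof -
  have "cross_agree I p r A B" using assms(1) unfolding max_cross_def by blast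
  then show ?thesis by (intro max_cross_lift[OF assms(1)] cross_agree_drop assms)
qed

text \<open>The competitor is the fibre of \<open>A\<close> over \<open>v\<close> against the glued
  union of the other \<open>p i - 1\<close> fibres of \<open>B\<close>, both lifted. Gluing loses at
  most a factor \<open>p i - 1\<close>, and (p i - 1) / (p i)^2 is c(1 - c) for c = 1 / p i.\<close>

lemma max_cross_fraction:
  assumes mx: "max_cross I p r A B" and I: "finite I" "i \<in> I" and v: "v \<in> {1..p i}"
    and pos: "card A > 0" "card B > 0"
  shows "card {x\<in>A. x i = v} / card A * (1 - card {y\<in>B. y i = v} / card B)
    \<le> 1 / p i * (1 - 1 / p i)"
proof -
  define D where "D = card (drop_coord i ({1..p i} - {v}) B)"
  have cr: "cross_agree I p r A B" using mx unfolding max_cross_def by blast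
  have fB: "finite B" using cross_agree_finite[OF cr I(1)] by blast
  have q: "p i > 0" using v by auto
  have "(p i)\<^sup>2 * (card {x\<in>A. x i = v} * D) \<le> card A * card B"
    using max_cross_disjoint[OF mx I, of "{v}" "{1..p i} - {v}"]
    unfolding D_def card_drop_single by blast
  from of_nat_mono[OF this, where 'a = real]
  have 1: "(real (p i))\<^sup>2 * (real (card {x\<in>A. x i = v}) * real D) \<le> real (card A) * real (card B)"
    by simp
  have "{y\<in>B. y i \<in> {1..p i} - {v}} = B - {y\<in>B. y i = v}"
    using cr cube_mem[OF _ I(2)] unfolding cross_agree_def by blast
  then have "card B - card {y\<in>B. y i = v} \<le> card ({1..p i} - {v}) * D"
    using card_le_drop[OF fB, of "{1..p i} - {v}" i] fB unfolding D_def
    by (simp add: card_Diff_subset)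
  then have "card B - card {y\<in>B. y i = v} \<le> (p i - 1) * D" using v by simp
  then have "real (card B) \<le> real (card {y\<in>B. y i = v}) + real ((p i - 1) * D)"
    by linarith
  then have 2: "real (card B) - card {y\<in>B. y i = v} \<le> (real (p i) - 1) * D"
    using q by simp
  have "(real (p i))\<^sup>2 * (card {x\<in>A. x i = v} * (real (card B) - card {y\<in>B. y i = v}))
      \<le> (real (p i))\<^sup>2 * (card {x\<in>A. x i = v} * ((real (p i) - 1) * D))"
    using 2 by (intro mult_left_mono) auto
  also have "\<dots> = (real (p i) - 1) * ((real (p i))\<^sup>2 * (real (card {x\<in>A. x i = v}) * real D))"
    by simp
  also have "\<dots> \<le> (real (p i) - 1) * (real (card A) * real (card B))"
    using 1 q by (intro mult_left_mono) auto
  finally show ?thesis using q pos by (simp add: field_simps power2_eq_square)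
qed

lemma sum_card_fibres:
  assumes "A \<subseteq> cube I p" "finite A" "i \<in> I"
  shows "(\<Sum>v\<in>{1..p i}. card {x\<in>A. x i = v}) = card A"
proof -
  have "x i \<in> {1..p i}" if "x \<in> A" for x
    by (rule cube_mem[OF subsetD[OF assms(1) that] assms(3)])
  then have "A = (\<Union>v\<in>{1..p i}. {x\<in>A. x i = v})" by blast
  then have "card A = card (\<Union>v\<in>{1..p i}. {x\<in>A. x i = v})" by simp
  also have "\<dots> = (\<Sum>v\<in>{1..p i}. card {x\<in>A. x i = v})"
    using assms(2) by (intro card_UN_disjoint) auto
  finally show ?thesis by simp
qed

lemma card_fibre_le_drop:
  assumes "finite B" "w \<in> M"
  shows "card {y\<in>B. y i = w} \<le> card (drop_coord i M B)"
  unfolding card_drop_single[symmetric]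
  using assms by (intro card_mono) (auto simp: drop_coord_def)

text \<open>Feeding the frequency 1 - 1 / p i back into the gluing inequality bounds the whole glued
  union of the other fibres of \<open>B\<close> by |B| / (p i (p i - 1)), and the fibre over
  \<open>w\<close> embeds into that union. So a single value is rarer by a factor
  \<open>p i - 1\<close> than the dichotomy tells.\<close>

lemma max_cross_rare_value:
  assumes mx: "max_cross I p r A B" and I: "finite I" "i \<in> I" and z: "z \<in> {1..p i}"
    and pos: "card A > 0" "card B > 0" and q: "2 \<le> p i"
    and big: "1 - card {x\<in>A. x i = z} / card A \<le> 1 / p i" and w: "w \<noteq> z"
  shows "real (p i) * (real (p i) - 1) * card {y\<in>B. y i = w} \<le> card B"
proof (cases "w \<in> {1..p i}")
  case True
  define D where "D = real (card (drop_coord i ({1..p i} - {z}) B))"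
  have cr: "cross_agree I p r A B" using mx unfolding max_cross_def by blast
  have fB: "finite B" using cross_agree_finite[OF cr I(1)] by blast
  have "(p i)\<^sup>2 * (card {x\<in>A. x i = z} * card (drop_coord i ({1..p i} - {z}) B)) \<le> card A * card B"
    using max_cross_disjoint[OF mx I, of "{z}" "{1..p i} - {z}"]
    unfolding card_drop_single by blast
  from of_nat_mono[OF this, where 'a = real]
  have 1: "(real (p i))\<^sup>2 * (real (card {x\<in>A. x i = z}) * D) \<le> real (card A) * real (card B)"
    unfolding D_def by simp
  have "(real (p i) - 1) * card A \<le> real (p i) * card {x\<in>A. x i = z}"
    using big pos q by (simp add: field_simps)
  then have "(real (p i) - 1) * card A * (real (p i) * D)
      \<le> real (p i) * card {x\<in>A. x i = z} * (real (p i) * D)"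
    unfolding D_def by (intro mult_right_mono) auto
  also have "\<dots> \<le> real (card A) * real (card B)" using 1 by (simp add: power2_eq_square algebra_simps)
  finally have "real (card A) * (real (p i) * (real (p i) - 1) * D) \<le> real (card A) * real (card B)"
    by (simp add: algebra_simps)
  then have D: "real (p i) * (real (p i) - 1) * D \<le> real (card B)" using pos by simp
  have "real (card {y\<in>B. y i = w}) \<le> D"
    unfolding D_def using card_fibre_le_drop[OF fB] True w by (simp del: One_nat_def)
  then have "real (p i) * (real (p i) - 1) * card {y\<in>B. y i = w} \<le> real (p i) * (real (p i) - 1) * D"
    using q by (intro mult_left_mono) auto
  then show ?thesis using D by linarith
next
  case False
  have "B \<subseteq> cube I p" using mx unfolding max_cross_def cross_agree_def by blast
  then have "{y\<in>B. y i = w} = {}" using False cube_mem[OF _ I(2)] by blast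
  then have "card {y\<in>B. y i = w} = 0" by (simp only: card.empty)
  then show ?thesis by simp
qed

text \<open>With all frequencies 1 / p i, gluing shows that the union of the fibres of
  \<open>B\<close> over all values but \<open>v\<close> is no larger than each one of them, so these
  fibres coincide after dropping \<open>i\<close>. Two given values can be compared through a third
  value \<open>v\<close>, hence \<open>3 \<le> p i\<close>.\<close>

lemma max_cross_balanced_irrelevant:
  assumes mx: "max_cross I p r A B" and I: "finite I" "i \<in> I"
    and pos: "card A > 0" "card B > 0" and q: "3 \<le> p i"
    and A: "\<And>v. v \<in> {1..p i} \<Longrightarrow> p i * card {x\<in>A. x i = v} = card A"
    and B: "\<And>v. v \<in> {1..p i} \<Longrightarrow> p i * card {y\<in>B. y i = v} = card B"
  shows "irrelevant p B i"
  unfolding irrelevant_def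
proof (intro ballI)
  have cr: "cross_agree I p r A B" using mx unfolding max_cross_def by blast
  have fB: "finite B" using cross_agree_finite[OF cr I(1)] by blast
  have eq: "drop_coord i {w} B = drop_coord i ({1..p i} - {v}) B"
    if vw: "v \<in> {1..p i}" "w \<in> {1..p i}" "w \<noteq> v" for v w
  proof (rule card_subset_eq)
    let ?D = "drop_coord i ({1..p i} - {v}) B"
    show "finite ?D" using fB unfolding drop_coord_def by simp
    show "drop_coord i {w} B \<subseteq> ?D" using vw unfolding drop_coord_def by auto
    have "(p i)\<^sup>2 * (card {x\<in>A. x i = v} * card ?D) \<le> card A * card B"
      using max_cross_disjoint[OF mx I, of "{v}" "{1..p i} - {v}"]
      unfolding card_drop_single by blast
    also have "(p i)\<^sup>2 * (card {x\<in>A. x i = v} * card ?D) = card A * (p i * card ?D)"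
      unfolding A[OF vw(1), symmetric] by (simp add: power2_eq_square)
    finally have "p i * card ?D \<le> p i * card {y\<in>B. y i = w}" using pos B[OF vw(2)] by simp
    then have "card ?D \<le> card {y\<in>B. y i = w}" using q by simp
    moreover have "card {y\<in>B. y i = w} \<le> card ?D"
      using vw by (intro card_fibre_le_drop fB) auto
    ultimately show "card (drop_coord i {w} B) = card ?D" unfolding card_drop_single by simp
  qed
  fix y w assume y: "y \<in> B" and w: "w \<in> {1..p i}"
  have "y \<in> cube I p" using y cr unfolding cross_agree_def by blast
  then have yi: "y i \<in> {1..p i}" using I(2) by (rule cube_mem)
  show "y(i := w) \<in> B"
  proof (cases "y i = w")
    case True then show ?thesis using y by (metis fun_upd_triv)
  next
    case False
    have "card {y i, w} < card {1..p i}" using q False by simp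
    then have "\<not> {1..p i} \<subseteq> {y i, w}" by (meson card_mono finite.emptyI finite.insertI not_le)
    then obtain v where v: "v \<in> {1..p i}" "v \<noteq> y i" "v \<noteq> w" by blast
    have "drop_coord i {y i} B = drop_coord i {w} B"
      using eq[OF v(1) yi] eq[OF v(1) w] v by metis
    moreover have "y(i := undefined) \<in> drop_coord i {y i} B" using y unfolding drop_coord_def by auto
    ultimately obtain y' where y': "y' \<in> B" "y' i = w" "y'(i := undefined) = y(i := undefined)"
      unfolding drop_coord_def by auto
    have "y' = y(i := w)" using y'(2,3) by (metis fun_upd_triv fun_upd_upd)
    then show ?thesis using y' by simp
  qed
qed

lemma all_eq_of_sum_eq:
  fixes V :: "'b set" and f :: "'b \<Rightarrow> real" and c :: real
  assumes "finite V" "\<And>u. u \<in> V \<Longrightarrow> f u \<le> c" "sum f V = card V * c" "v \<in> V"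
  shows "f v = c"
proof -
  have "(\<Sum>v\<in>V. c - f v) = 0" using assms(3) by (simp add: sum_subtractf)
  then show ?thesis using assms(1,2,4) by (simp add: sum_nonneg_eq_0_iff)
qed

lemma max_cross_dominant_value:
  assumes mx: "max_cross I p r A B" and I: "finite I" "r \<le> card I" "\<forall>i\<in>I. 3 \<le> p i"
    and i: "i \<in> I" and rel: "\<not> irrelevant p B i"
  obtains z where "z \<in> {1..p i}"
    "\<And>v. v \<noteq> z \<Longrightarrow> real (p i) * (real (p i) - 1) * card {x\<in>A. x i = v} \<le> card A"
    "\<And>v. v \<noteq> z \<Longrightarrow> real (p i) * (real (p i) - 1) * card {y\<in>B. y i = v} \<le> card B"
proof -
  have cr: "cross_agree I p r A B" using mx unfolding max_cross_def by blast
  have fin: "finite A" "finite B" using cross_agree_finite[OF cr I(1)] by blast+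
  have p1: "\<forall>i\<in>I. 1 \<le> p i" using I(3) by force
  note pos = max_cross_pos[OF mx I(1,2) p1]
  have q: "3 \<le> p i" using I(3) i by blast
  define \<alpha> where "\<alpha> v = card {x\<in>A. x i = v} / card A" for v
  define \<beta> where "\<beta> v = card {y\<in>B. y i = v} / card B" for v
  define c :: real where "c = 1 / p i"
  have le: "card {x\<in>X. x i = v} \<le> card X" if "finite X" for X :: "('a \<Rightarrow> nat) set" and v
    using that by (intro card_mono) auto
  have di: "\<alpha> v \<le> c \<and> \<beta> v \<le> c \<or> 1 - \<alpha> v \<le> c \<and> 1 - \<beta> v \<le> c" if v: "v \<in> {1..p i}" for v :: nat
  proof (rule dichotomy)
    show "\<alpha> v * (1 - \<beta> v) \<le> c * (1 - c)" "\<beta> v * (1 - \<alpha> v) \<le> c * (1 - c)"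
      unfolding \<alpha>_def \<beta>_def c_def
      using max_cross_fraction[OF mx I(1) i v pos]
        max_cross_fraction[OF max_cross_sym[OF mx] I(1) i v pos(2,1)] by auto
    show "\<alpha> v \<le> 1" "\<beta> v \<le> 1" using le[OF fin(1), of v] le[OF fin(2), of v] pos
      unfolding \<alpha>_def \<beta>_def by auto
  qed (use q in \<open>auto simp: \<alpha>_def \<beta>_def c_def\<close>)
  show ?thesis
  proof (cases "\<exists>z\<in>{1..p i}. 1 - \<alpha> z \<le> c \<and> 1 - \<beta> z \<le> c")
    case True
    then obtain z where z: "z \<in> {1..p i}" "1 - \<alpha> z \<le> c" "1 - \<beta> z \<le> c" by blast
    show ?thesis
    proof (rule that[OF z(1)])
      fix v assume v: "v \<noteq> z"
      show "real (p i) * (real (p i) - 1) * card {y\<in>B. y i = v} \<le> card B"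
        using max_cross_rare_value[OF mx I(1) i z(1) pos _ _ v] z(2) q unfolding \<alpha>_def c_def by simp
      show "real (p i) * (real (p i) - 1) * card {x\<in>A. x i = v} \<le> card A"
        using max_cross_rare_value[OF max_cross_sym[OF mx] I(1) i z(1) pos(2,1) _ _ v] z(3) q
        unfolding \<beta>_def c_def by simp
    qed
  next
    case False
    then have small: "\<alpha> v \<le> c" "\<beta> v \<le> c" if "v \<in> {1..p i}" for v :: nat using di that by blast+
    have sub: "A \<subseteq> cube I p" "B \<subseteq> cube I p" using cr unfolding cross_agree_def by blast+
    \<comment> \<open>Here \<open>p i\<close> numbers, each at most 1 / p i, have sum 1, so all are
      equal to 1 / p i: the balanced case, which makes the coordinate irrelevant.\<close>
    have "sum \<alpha> {1..p i} = 1" "sum \<beta> {1..p i} = 1"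
      unfolding \<alpha>_def \<beta>_def sum_divide_distrib[symmetric] of_nat_sum[symmetric]
        sum_card_fibres[OF sub(1) fin(1) i] sum_card_fibres[OF sub(2) fin(2) i] using pos by auto
    then have "sum \<alpha> {1..p i} = card {1..p i} * c" "sum \<beta> {1..p i} = card {1..p i} * c"
      using q unfolding c_def by auto
    then have eq: "\<alpha> v = c" "\<beta> v = c" if "v \<in> {1..p i}" for v :: nat
      using all_eq_of_sum_eq[where V = "{1..p i}" and f = \<alpha> and c = c and v = v]
        all_eq_of_sum_eq[where V = "{1..p i}" and f = \<beta> and c = c and v = v] small that
      by auto
    have "irrelevant p B i"
    proof (rule max_cross_balanced_irrelevant[OF mx I(1) i pos q])
      fix v assume "v \<in> {1..p i}"
      then have "real (p i * card {x\<in>A. x i = v}) = real (card A)"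
        "real (p i * card {y\<in>B. y i = v}) = real (card B)"
        using eq[of v] pos q unfolding \<alpha>_def \<beta>_def c_def by (simp_all add: field_simps)
      then show "p i * card {x\<in>A. x i = v} = card A" "p i * card {y\<in>B. y i = v} = card B"
        by (simp_all only: of_nat_eq_iff)
    qed
    then show ?thesis using rel by blast
  qed
qed

section \<open>Removing irrelevant coordinates\<close>

lemma drop_coordI: "x \<in> A \<Longrightarrow> x i \<in> L \<Longrightarrow> x(i := undefined) \<in> drop_coord i L A"
  unfolding drop_coord_def by blast

lemma drop_coordE:
  assumes "y \<in> drop_coord i L A"
  obtains x where "x \<in> A" "x i \<in> L" "y = x(i := undefined)"
  using assms unfolding drop_coord_def by blast

lemma irrelevant_drop:
  assumes A: "A \<subseteq> cube I p" and irr: "irrelevant p A i" and i: "i \<in> I"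
  shows "lift p i (drop_coord i {1..p i} A) = A"
    and "A = {x \<in> cube I p. x(i := undefined) \<in> drop_coord i {1..p i} A}"
proof -
  have xi: "x i \<in> {1..p i}" if "x \<in> A" for x
    by (rule cube_mem[OF subsetD[OF A that] i])
  have *: "x(i := v) \<in> A" if x: "x(i := undefined) \<in> drop_coord i {1..p i} A" and v: "v \<in> {1..p i}" for x v
  proof -
    obtain x' where x': "x' \<in> A" "x(i := undefined) = x'(i := undefined)"
      using x by (rule drop_coordE)
    then have "x(i := v) = x'(i := v)" by (metis fun_upd_upd)
    then show ?thesis using x'(1) irr v unfolding irrelevant_def by simp
  qed
  have in_drop: "x(i := undefined) \<in> drop_coord i {1..p i} A" if "x \<in> A" for x
    by (rule drop_coordI[OF that xi[OF that]])
  show "A = {x \<in> cube I p. x(i := undefined) \<in> drop_coord i {1..p i} A}"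
  proof (intro equalityI subsetI CollectI conjI)
    fix x assume "x \<in> A"
    then show "x \<in> cube I p" "x(i := undefined) \<in> drop_coord i {1..p i} A"
      by (fact subsetD[OF A], fact in_drop)
  next
    fix x assume "x \<in> {x \<in> cube I p. x(i := undefined) \<in> drop_coord i {1..p i} A}"
    then show "x \<in> A" using *[of x "x i"] cube_mem[OF _ i, of x p] by simp
  qed
  show "lift p i (drop_coord i {1..p i} A) = A"
  proof (intro equalityI subsetI)
    fix x assume "x \<in> lift p i (drop_coord i {1..p i} A)"
    then obtain v y where v: "v \<in> {1..p i}" "y \<in> drop_coord i {1..p i} A" "x = y(i := v)"
      unfolding lift_def by (auto simp del: One_nat_def)
    from v(2) have "y(i := undefined) = y" by (elim drop_coordE) simp
    then show "x \<in> A" using *[of y v] v by simp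
  next
    fix x assume x: "x \<in> A"
    then have "x = (\<lambda>(v, y). y(i := v)) (x i, x(i := undefined))" by simp
    then show "x \<in> lift p i (drop_coord i {1..p i} A)"
      unfolding lift_def by (rule image_eqI) (intro SigmaI in_drop[OF x] xi[OF x])
  qed
qed

text \<open>A member of \<open>A\<close> may be moved off \<open>y i\<close>, so \<open>r\<close>
  agreements always lie outside \<open>i\<close> and deleting \<open>i\<close> keeps the pair
  cross-agreeing. A better pair without \<open>i\<close> would lift to a better pair with
  \<open>i\<close>.\<close>

lemma max_cross_remove_irrelevant:
  assumes mx: "max_cross I p r A B" and I: "finite I" "r \<le> card I" "\<forall>i\<in>I. 2 \<le> p i"
    and i: "i \<in> I" and irr: "irrelevant p A i"
  shows "max_cross (I - {i}) p r (drop_coord i {1..p i} A) (drop_coord i {1..p i} B)"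
    and "card A = p i * card (drop_coord i {1..p i} A)"
proof -
  let ?A = "drop_coord i {1..p i} A" and ?B = "drop_coord i {1..p i} B"
  have cr: "cross_agree I p r A B" using mx unfolding max_cross_def by blast
  then have sub: "A \<subseteq> cube I p" "B \<subseteq> cube I p" unfolding cross_agree_def by blast+
  have irrB: "irrelevant p B i" using irrelevant_transfer[OF mx I i irr] .
  have sub': "?A \<subseteq> cube (I - {i}) p" "?B \<subseteq> cube (I - {i}) p"
    using sub unfolding drop_coord_def cube_def by (auto simp: PiE_iff extensional_def subset_iff)
  have cA: "card A = p i * card ?A"
    using card_lift[OF sub'(1)] irrelevant_drop(1)[OF sub(1) irr i] by simp
  have cB: "card B = p i * card ?B"
    using card_lift[OF sub'(2)] irrelevant_drop(1)[OF sub(2) irrB i] by simp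
  show "card A = p i * card ?A" by (fact cA)
  have q: "2 \<le> p i" using I i by blast
  show "max_cross (I - {i}) p r ?A ?B"
    unfolding max_cross_def
  proof (intro conjI allI impI)
    show "cross_agree (I - {i}) p r ?A ?B" unfolding cross_agree_def
    proof (intro conjI ballI sub')
      fix x y assume "x \<in> ?A" "y \<in> ?B"
      then obtain x' y' where e: "x' \<in> A" "y' \<in> B" "x = x'(i := undefined)" "y = y'(i := undefined)"
        unfolding drop_coord_def by auto
      define w where "w = (if y' i = 1 then 2 else 1 :: nat)"
      have w: "w \<in> {1..p i}" "w \<noteq> y' i" unfolding w_def using q by auto
      then have "x'(i := w) \<in> A" using irr e(1) unfolding irrelevant_def by blast
      then have "r \<le> card {j\<in>I. (x'(i := w)) j = y' j}" using cr e(2) unfolding cross_agree_def by blast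
      also have "{j\<in>I. (x'(i := w)) j = y' j} = {j\<in>I - {i}. x j = y j}" using e w(2) by auto
      finally show "r \<le> card {j\<in>I - {i}. x j = y j}" .
    qed
    fix C D assume "cross_agree (I - {i}) p r C D"
    then have "(p i)\<^sup>2 * (card C * card D) \<le> (p i)\<^sup>2 * (card ?A * card ?B)"
      using max_cross_lift[OF mx _ i I(1)] cA cB
      by (metis (no_types, opaque_lifting) mult.assoc mult.left_commute power2_eq_square)
    then show "card C * card D \<le> card ?A * card ?B" using q by simp
  qed
qed

lemma max_cross_card_le:
  assumes "max_cross I p r A B" "finite I" "card A > 0" "card B > 0"
  shows "r \<le> card I"
proof -
  obtain x y where "x \<in> A" "y \<in> B" using assms(3,4) by (metis card_gt_0_iff ex_in_conv)
  then have "r \<le> card {i\<in>I. x i = y i}"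
    using assms(1) unfolding max_cross_def cross_agree_def by blast
  also have "\<dots> \<le> card I" using assms(2) by (intro card_mono) auto
  finally show ?thesis .
qed

text \<open>Irrelevance passes between the two families, so coordinates can be deleted from both one
  at a time. The form \<open>restrict x T\<close> lets a ball on the surviving coordinates be read
  as a Hamming ball of the full space in the coordinates \<open>T\<close>.\<close>

lemma max_cross_reduce:
  assumes "max_cross I p r A B" "finite I" "r \<le> card I" "\<forall>i\<in>I. 2 \<le> p i"
  shows "\<exists>T A' B'. T \<subseteq> I \<and> r \<le> card T \<and> max_cross T p r A' B' \<and>
    (\<forall>i\<in>T. \<not> irrelevant p A' i \<and> \<not> irrelevant p B' i) \<and>
    A = {x \<in> cube I p. restrict x T \<in> A'} \<and> B = {x \<in> cube I p. restrict x T \<in> B'} \<and>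
    card A = (\<Prod>i\<in>I - T. p i) * card A' \<and> card B = (\<Prod>i\<in>I - T. p i) * card B'"
  using assms
proof (induction "card I" arbitrary: I A B rule: less_induct)
  case (less I)
  note mx = less.prems(1) and I = less.prems(2-4)
  have cr: "cross_agree I p r A B" using mx unfolding max_cross_def by blast
  then have sub: "A \<subseteq> cube I p" "B \<subseteq> cube I p" unfolding cross_agree_def by blast+
  show ?case
  proof (cases "\<exists>i\<in>I. irrelevant p A i \<or> irrelevant p B i")
    case False
    have "restrict x I = x" if "x \<in> cube I p" for x
      using that unfolding cube_def by (rule PiE_restrict)
    then have "X = {x \<in> cube I p. restrict x I \<in> X}" if "X \<subseteq> cube I p" for X
      using that by (intro equalityI subsetI CollectI conjI) (auto simp: subset_iff)
    then have "A = {x \<in> cube I p. restrict x I \<in> A}" "B = {x \<in> cube I p. restrict x I \<in> B}"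
      using sub by blast+
    moreover have "card X = (\<Prod>i\<in>I - I. p i) * card X" for X :: "('a \<Rightarrow> nat) set" by simp
    ultimately show ?thesis
      using mx I False by blast
  next
    case True
    then obtain i where i: "i \<in> I" and irr: "irrelevant p A i" "irrelevant p B i"
      using irrelevant_transfer[OF mx I] irrelevant_transfer[OF max_cross_sym[OF mx] I] by blast
    let ?A = "drop_coord i {1..p i} A" and ?B = "drop_coord i {1..p i} B"
    note A = max_cross_remove_irrelevant[OF mx I i irr(1)]
      and B = max_cross_remove_irrelevant(2)[OF max_cross_sym[OF mx] I i irr(2)]
    have p1: "\<forall>i\<in>I. 1 \<le> p i" using I(3) by force
    have pos: "card ?A > 0" "card ?B > 0"
      using max_cross_pos[OF mx I(1,2) p1] A(2) B by (metis mult_0_right not_gr_zero)+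
    have le: "r \<le> card (I - {i})" using max_cross_card_le[OF A(1) _ pos] I(1) by blast
    have "card (I - {i}) < card I" using i I(1) by (intro psubset_card_mono) auto
    from less.hyps[OF this A(1) _ le] I obtain T A' B' where T: "T \<subseteq> I - {i}" "r \<le> card T"
      "max_cross T p r A' B'" "\<forall>i\<in>T. \<not> irrelevant p A' i \<and> \<not> irrelevant p B' i"
      and A': "?A = {x \<in> cube (I - {i}) p. restrict x T \<in> A'}" "card ?A = (\<Prod>i\<in>I - {i} - T. p i) * card A'"
      and B': "?B = {x \<in> cube (I - {i}) p. restrict x T \<in> B'}" "card ?B = (\<Prod>i\<in>I - {i} - T. p i) * card B'"
      by blast
    have dc: "x(i := undefined) \<in> cube (I - {i}) p" if "x \<in> cube I p" for x
      using that unfolding cube_def by (auto simp: PiE_iff extensional_def)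
    have re: "restrict (x(i := undefined)) T = restrict x T" for x :: "'a \<Rightarrow> nat"
      using T(1) by (intro restrict_ext) auto
    have "I - T = insert i (I - {i} - T)" using T(1) i by auto
    then have pr: "(\<Prod>i\<in>I - T. p i) = p i * (\<Prod>i\<in>I - {i} - T. p i)" using I(1) by simp
    have "x(i := undefined) \<in> ?A \<longleftrightarrow> restrict x T \<in> A'" if "x \<in> cube I p" for x
      by (subst A'(1)) (simp add: dc[OF that] re)
    then have eqA: "A = {x \<in> cube I p. restrict x T \<in> A'}"
      by (intro trans[OF irrelevant_drop(2)[OF sub(1) irr(1) i]]) auto
    have "x(i := undefined) \<in> ?B \<longleftrightarrow> restrict x T \<in> B'" if "x \<in> cube I p" for x
      by (subst B'(1)) (simp add: dc[OF that] re)
    then have eqB: "B = {x \<in> cube I p. restrict x T \<in> B'}"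
      by (intro trans[OF irrelevant_drop(2)[OF sub(2) irr(2) i]]) auto
    have cA: "card A = (\<Prod>i\<in>I - T. p i) * card A'" and cB: "card B = (\<Prod>i\<in>I - T. p i) * card B'"
      using A(2) B A'(2) B'(2) pr by simp_all
    have "T \<subseteq> I" using T(1) by blast
    show ?thesis
      by (rule exI[of _ T], rule exI[of _ A'], rule exI[of _ B'])
        (intro conjI \<open>T \<subseteq> I\<close> T(2-4) eqA eqB cA cB)
  qed
qed

section \<open>Entropy bound for pairs with a dominant value in every coordinate\<close>

text \<open>An upper bound for the entropy of a variable on \<open>q\<close> values whose most frequent value has
  probability at least \<open>1 - 1 / q\<close> is \<open>gap q = ln q - loss q\<close>.\<close>

definition loss :: "real \<Rightarrow> real" where "loss q = (1 - 2 / q) * ln (q - 1)"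

definition gap :: "real \<Rightarrow> real" where "gap q = ln q - loss q"

text \<open>Rarity is assumed for single values. The total frequency 1 / p i of leaving
  \<open>z i\<close> follows by summation in \<open>off_center\<close>, while the sharper
  single-value form is needed when a particular vector \<open>x\<close> prescribes the values, as in
  \<open>card_supp_le\<close>.\<close>

locale centered_pair =
  fixes I :: "'i set" and p :: "'i \<Rightarrow> nat" and r :: nat and A B :: "('i \<Rightarrow> nat) set"
    and z :: "'i \<Rightarrow> nat"
  assumes finI: "finite I" and mx: "max_cross I p r A B" and rle: "r \<le> card I"
    and p3: "i \<in> I \<Longrightarrow> 3 \<le> p i" and z: "z \<in> cube I p"
    and rareA: "i \<in> I \<Longrightarrow> v \<noteq> z i \<Longrightarrow>
      real (p i) * (real (p i) - 1) * card {x\<in>A. x i = v} \<le> card A"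
    and rareB: "i \<in> I \<Longrightarrow> v \<noteq> z i \<Longrightarrow>
      real (p i) * (real (p i) - 1) * card {y\<in>B. y i = v} \<le> card B"
begin

text \<open>Estimates are proved for one family only; the mirror images come from this
  symmetry.\<close>

lemma swap: "centered_pair I p r B A z"
proof (rule centered_pair.intro)
  fix i v assume i: "i \<in> I"
  show "3 \<le> p i" by (rule p3[OF i])
  assume "v \<noteq> z i"
  with i show "real (p i) * (real (p i) - 1) * card {x\<in>B. x i = v} \<le> card B"
    "real (p i) * (real (p i) - 1) * card {x\<in>A. x i = v} \<le> card A"
    by (rule rareB, rule rareA)
qed (rule finI max_cross_sym[OF mx] rle z)+

lemma cross: "cross_agree I p r A B"
  using mx unfolding max_cross_def by blast

lemma subs: "A \<subseteq> cube I p" "B \<subseteq> cube I p"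
  using cross unfolding cross_agree_def by blast+

lemma fins: "finite A" "finite B"
  using cross_agree_finite[OF cross finI] by blast+

lemma p_ge_1: "\<forall>i\<in>I. 1 \<le> p i"
  using p3 by force

lemma cards_pos: "card A > 0" "card B > 0"
  by (fact max_cross_pos[OF mx finI rle p_ge_1])+

lemma z_mem: "i \<in> I \<Longrightarrow> z i \<in> {1..p i}"
  using z by (rule cube_mem)

definition supp :: "('i \<Rightarrow> nat) \<Rightarrow> 'i set" where "supp x = {i\<in>I. x i \<noteq> z i}"

lemma supp_subset: "supp x \<subseteq> I" and finite_supp: "finite (supp x)"
  unfolding supp_def using finI by auto

lemma off_center:
  assumes "i \<in> I" shows "real (p i) * card {x\<in>A. x i \<noteq> z i} \<le> card A"
proof -
  define V where "V = {1..p i} - {z i}"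
  have q: "3 \<le> p i" using p3 assms by blast
  have "x i \<in> {1..p i}" if "x \<in> A" for x by (rule cube_mem[OF subsetD[OF subs(1) that] assms])
  then have "{x\<in>A. x i \<noteq> z i} = (\<Union>v\<in>V. {x\<in>A. x i = v})" unfolding V_def by blast
  then have "card {x\<in>A. x i \<noteq> z i} \<le> (\<Sum>v\<in>V. card {x\<in>A. x i = v})"
    by (simp add: card_UN_le V_def)
  then have "real (card {x\<in>A. x i \<noteq> z i}) \<le> (\<Sum>v\<in>V. real (card {x\<in>A. x i = v}))"
    by (simp flip: of_nat_sum)
  also have "\<dots> \<le> (\<Sum>v\<in>V. card A / (real (p i) * (real (p i) - 1)))"
  proof (rule sum_mono)
    fix v assume "v \<in> V"
    then have "v \<noteq> z i" unfolding V_def by blast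
    then show "real (card {x\<in>A. x i = v}) \<le> card A / (real (p i) * (real (p i) - 1))"
      using rareA[OF assms, of v] q by (simp add: field_simps)
  qed
  also have "\<dots> = card A / p i"
  proof -
    have "card V = p i - 1" using z_mem[OF assms] unfolding V_def by simp
    then have "real (card V) = real (p i) - 1" using q by simp
    then have "(\<Sum>v\<in>V. card A / (real (p i) * (real (p i) - 1)))
        = (real (p i) - 1) * (card A / (real (p i) * (real (p i) - 1)))"
      by (simp only: sum_constant)
    also have "\<dots> = card A / p i" using q by simp
    finally show ?thesis .
  qed
  finally show ?thesis using q by (simp add: field_simps)
qed

text \<open>Suppose \<open>x\<close> leaves \<open>z\<close> at s + 1 places, s = card I - r. A
  vector of \<open>B\<close> differing from \<open>x\<close> at all of them would have fewer than
  \<open>r\<close> agreements, so all of \<open>B\<close> is covered by s + 1 fibres over rare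
  values. Each holds a share of at most 1 / (s + 2), which is too little.\<close>

lemma card_supp_le:
  assumes x: "x \<in> A" and small: "\<And>i. i \<in> I \<Longrightarrow> card I - r + 1 < p i * (p i - 1)"
  shows "card (supp x) \<le> card I - r"
proof (rule ccontr)
  define s where "s = card I - r"
  assume "\<not> card (supp x) \<le> card I - r"
  then have "s + 1 \<le> card (supp x)" unfolding s_def by simp
  then obtain S where S: "S \<subseteq> supp x" "card S = s + 1" by (meson obtain_subset_with_card_n)
  have SI: "S \<subseteq> I" using S(1) supp_subset by blast
  then have finS: "finite S" using finI finite_subset by blast
  have "\<exists>i\<in>S. y i = x i" if y: "y \<in> B" for y
  proof (rule ccontr)
    assume "\<not> (\<exists>i\<in>S. y i = x i)"
    then have "{i\<in>I. x i = y i} \<subseteq> I - S" by force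
    then have "card {i\<in>I. x i = y i} \<le> card (I - S)" using finI by (intro card_mono) auto
    also have "\<dots> = card I - (s + 1)" using SI S(2) finS by (simp add: card_Diff_subset)
    also have "\<dots> < r" using card_mono[OF finI SI] S(2) unfolding s_def by simp
    finally show False using x y cross unfolding cross_agree_def by force
  qed
  then have "B = (\<Union>i\<in>S. {y\<in>B. y i = x i})" by blast
  then have "card B = card (\<Union>i\<in>S. {y\<in>B. y i = x i})" by (rule arg_cong)
  also have "\<dots> \<le> (\<Sum>i\<in>S. card {y\<in>B. y i = x i})" by (rule card_UN_le[OF finS])
  finally have "real (card B) \<le> (\<Sum>i\<in>S. real (card {y\<in>B. y i = x i}))"
    by (simp flip: of_nat_sum)
  also have "\<dots> \<le> (\<Sum>i\<in>S. card B / (s + 2))"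
  proof (rule sum_mono)
    fix i assume "i \<in> S"
    then have i: "i \<in> I" "x i \<noteq> z i" using S(1) unfolding supp_def by auto
    have "s + 2 \<le> p i * (p i - 1)" using small[OF i(1)] unfolding s_def by simp
    from of_nat_mono[OF this, where 'a = real]
    have "real (s + 2) \<le> real (p i) * (real (p i) - 1)" using p3[OF i(1)] by simp
    then have "real (s + 2) * card {y\<in>B. y i = x i} \<le> real (p i) * (real (p i) - 1) * card {y\<in>B. y i = x i}"
      by (intro mult_right_mono) auto
    also have "\<dots> \<le> card B" by (rule rareB[OF i])
    finally show "real (card {y\<in>B. y i = x i}) \<le> card B / (s + 2)" by (simp add: field_simps)
  qed
  also have "\<dots> = (s + 1) * (card B / (s + 2))" using S(2) by simp
  also have "\<dots> < card B" using cards_pos(2) by (simp add: field_simps)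
  finally show False by simp
qed

text \<open>Gibbs' inequality with weight \<open>1 - 1 / p i\<close> on \<open>z i\<close> and equal weights on the other values;
  no entropy is needed explicitly.\<close>

lemma ln_card_le: "ln (card A) \<le> (\<Sum>i\<in>I. gap (p i))"
proof -
  define w :: "'i \<Rightarrow> nat \<Rightarrow> real"
    where "w i v = (if v = z i then 1 - 1 / p i else 1 / (real (p i) * (real (p i) - 1)))" for i v
  define F where "F x = (\<Sum>i\<in>I. ln (w i (x i)))" for x
  define c where "c = (\<Sum>x\<in>A. F x) / card A"
  have wpos: "w i v > 0" if "i \<in> I" for i v using p3[OF that] unfolding w_def by auto
  have wsum: "(\<Sum>v\<in>{1..p i}. w i v) = 1" if i: "i \<in> I" for i
  proof -
    have "(\<Sum>v\<in>{1..p i}. w i v) = w i (z i) + (\<Sum>v\<in>{1..p i} - {z i}. w i v)"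
      using z_mem[OF i] by (simp add: sum.remove)
    also have "(\<Sum>v\<in>{1..p i} - {z i}. w i v)
        = (\<Sum>v\<in>{1..p i} - {z i}. 1 / (real (p i) * (real (p i) - 1)))"
      by (rule sum.cong) (auto simp: w_def)
    also have "\<dots> = 1 / p i" using z_mem[OF i] p3[OF i] by (simp add: field_simps)
    finally show ?thesis unfolding w_def by simp
  qed
  have expF: "exp (F x) = (\<Prod>i\<in>I. w i (x i))" for x
    unfolding F_def exp_sum[OF finI] using wpos by (intro prod.cong) auto
  \<comment> \<open>Jensen by the tangent of exp at the mean \<open>c\<close> of \<open>F\<close>:
    the linear terms cancel over \<open>A\<close>, so exp c * |A| is at most the weight of
    \<open>A\<close>, which is at most the total weight 1.\<close>
  have "exp c * card A = (\<Sum>x\<in>A. exp c * (1 + (F x - c)))"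
  proof -
    have "(\<Sum>x\<in>A. exp c * (1 + (F x - c))) = exp c * (card A + ((\<Sum>x\<in>A. F x) - card A * c))"
      by (simp add: sum.distrib sum_subtractf flip: sum_distrib_left)
    moreover have "(\<Sum>x\<in>A. F x) = card A * c" using cards_pos(1) unfolding c_def by simp
    ultimately show ?thesis by simp
  qed
  also have "\<dots> \<le> (\<Sum>x\<in>A. exp c * exp (F x - c))"
    by (intro sum_mono mult_left_mono exp_ge_add_one_self) auto
  also have "\<dots> = (\<Sum>x\<in>A. exp (F x))" by (simp flip: exp_add)
  also have "\<dots> \<le> (\<Sum>x\<in>cube I p. exp (F x))"
    using finite_cube[OF finI] subs by (intro sum_mono2) auto
  also have "\<dots> = (\<Prod>i\<in>I. \<Sum>v\<in>{1..p i}. w i v)"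
    unfolding expF cube_def using finI by (subst prod_sum_PiE) auto
  also have "\<dots> = 1" using wsum by simp
  finally have "ln (exp c * card A) \<le> 0" using cards_pos(1) by simp
  then have 1: "ln (card A) \<le> - c" using cards_pos(1) by (simp add: ln_mult)
  have "card A * (- gap (p i)) \<le> (\<Sum>x\<in>A. ln (w i (x i)))" if i: "i \<in> I" for i
  proof -
    define k where "k = card {x\<in>A. x i \<noteq> z i}"
    define q where "q = real (p i)"
    have q: "q \<ge> 3" using p3[OF i] unfolding q_def by simp
    have kq: "q * k \<le> card A" using off_center[OF i] unfolding k_def q_def .
    have "(\<Sum>x\<in>A. ln (w i (x i))) = (\<Sum>x\<in>{x\<in>A. x i = z i}. ln (1 - 1 / q))
        + (\<Sum>x\<in>{x\<in>A. x i \<noteq> z i}. ln (1 / (q * (q - 1))))"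
    proof -
      have "(\<Sum>x\<in>A. ln (w i (x i))) = (\<Sum>x\<in>A. if x i = z i then ln (1 - 1 / q) else ln (1 / (q * (q - 1))))"
        unfolding w_def q_def by (intro sum.cong) auto
      moreover have "A \<inter> {x. x i = z i} = {x\<in>A. x i = z i}"
        "A \<inter> - {x. x i = z i} = {x\<in>A. x i \<noteq> z i}" by auto
      ultimately show ?thesis by (simp only: sum.If_cases[OF fins(1)])
    qed
    also have "card {x\<in>A. x i = z i} = card A - k"
    proof -
      have "{x\<in>A. x i = z i} = A - {x\<in>A. x i \<noteq> z i}" by blast
      then show ?thesis unfolding k_def using fins by (simp add: card_Diff_subset)
    qed
    then have "(\<Sum>x\<in>{x\<in>A. x i = z i}. ln (1 - 1 / q)) = (real (card A) - k) * ln (1 - 1 / q)"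
      using card_mono[of A "{x\<in>A. x i \<noteq> z i}"] fins unfolding k_def by simp
    also have "(\<Sum>x\<in>{x\<in>A. x i \<noteq> z i}. ln (1 / (q * (q - 1)))) = k * ln (1 / (q * (q - 1)))"
      unfolding k_def by simp
    also have "ln (1 - 1 / q) = ln (q - 1) - ln q"
    proof -
      have "1 - 1 / q = (q - 1) / q" using q by (simp add: field_simps)
      then show ?thesis using q by (simp add: ln_div)
    qed
    also have "ln (1 / (q * (q - 1))) = - ln q - ln (q - 1)" using q by (simp add: ln_div ln_mult)
    finally have *: "(\<Sum>x\<in>A. ln (w i (x i)))
        = card A * (ln (q - 1) - ln q) - 2 * k * ln (q - 1)" by (simp add: algebra_simps)
    \<comment> \<open>Leaving \<open>z i\<close> lowers the log weight by 2 ln (q - 1), and at most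
      |A| / q members do so.\<close>
    have "q * k * (2 / q * ln (q - 1)) \<le> card A * (2 / q * ln (q - 1))"
      using kq q by (intro mult_right_mono) auto
    then have "2 * k * ln (q - 1) \<le> card A * (2 / q * ln (q - 1))" using q by simp
    then show ?thesis unfolding * gap_def loss_def q_def[symmetric] by (simp add: algebra_simps)
  qed
  then have "(\<Sum>i\<in>I. card A * (- gap (p i))) \<le> (\<Sum>i\<in>I. \<Sum>x\<in>A. ln (w i (x i)))"
    by (intro sum_mono) auto
  also have "\<dots> = card A * c" unfolding c_def F_def using cards_pos(1) by (subst sum.swap) simp
  finally have "card A * (- c) \<le> card A * (\<Sum>i\<in>I. gap (p i))"
    by (simp add: sum_negf flip: sum_distrib_left)
  then have "- c \<le> (\<Sum>i\<in>I. gap (p i))"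
    by (rule mult_left_le_imp_le) (use cards_pos in simp)
  then show ?thesis using 1 by simp
qed

text \<open>The entropy bounds put |A||B| below the exponential of twice the sum of all gaps, the
  subcube fixing \<open>R\<close> puts it above a squared product. As
  \<open>ln q - gap q = loss q\<close>, what remains outside \<open>R\<close> is the loss.\<close>

lemma sum_loss_le:
  assumes R: "R \<subseteq> I" "card R = r"
  shows "(\<Sum>i\<in>I - R. loss (p i)) \<le> (\<Sum>i\<in>R. gap (p i))"
proof -
  have "(\<Prod>i\<in>I - R. p i)\<^sup>2 \<le> card A * card B" using max_cross_ge[OF mx finI R p_ge_1] .
  from of_nat_mono[OF this, where 'a = real]
  have "(\<Prod>i\<in>I - R. real (p i))\<^sup>2 \<le> real (card A) * real (card B)" by simp
  moreover have pp: "(\<Prod>i\<in>I - R. real (p i)) > 0" using p3 by (intro prod_pos) force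
  ultimately have "ln ((\<Prod>i\<in>I - R. real (p i))\<^sup>2) \<le> ln (real (card A) * real (card B))"
    using cards_pos by (subst ln_le_cancel_iff) auto
  then have "2 * ln (\<Prod>i\<in>I - R. real (p i)) \<le> ln (card A) + ln (card B)"
    using pp cards_pos by (simp add: ln_realpow ln_mult)
  also have "\<dots> \<le> 2 * (\<Sum>i\<in>I. gap (p i))"
    using ln_card_le centered_pair.ln_card_le[OF swap] by simp
  finally have "ln (\<Prod>i\<in>I - R. real (p i)) \<le> (\<Sum>i\<in>I. gap (p i))" by simp
  moreover have "ln (\<Prod>i\<in>I - R. real (p i)) = (\<Sum>i\<in>I - R. ln (p i))"
    using finI p3 by (intro ln_prod) force+
  moreover have "(\<Sum>i\<in>I. gap (p i)) = (\<Sum>i\<in>I - R. gap (p i)) + (\<Sum>i\<in>R. gap (p i))"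
    using R finI by (intro sum.subset_diff) auto
  ultimately have "(\<Sum>i\<in>I - R. ln (p i) - gap (p i)) \<le> (\<Sum>i\<in>R. gap (p i))"
    by (simp add: sum_subtractf)
  then show ?thesis unfolding gap_def by simp
qed

end

section \<open>Monotonicity of \<open>loss\<close> and \<open>gap\<close>\<close>

lemma loss_mono:
  assumes "3 \<le> a" "a \<le> b" shows "loss a \<le> loss b"
proof -
  have "2 / b \<le> 2 / a" using assms by (intro divide_left_mono) auto
  moreover have "2 / a \<le> 1" using assms by simp
  ultimately show ?thesis unfolding loss_def using assms by (intro mult_mono) auto
qed

lemma loss_pos: "3 \<le> a \<Longrightarrow> 0 < loss a"
  unfolding loss_def by (intro mult_pos_pos) simp_all

lemma ln_ge_1: "3 \<le> x \<Longrightarrow> 1 \<le> ln (x :: real)"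
  using exp_le by (simp add: ln_ge_iff)

text \<open>The derivative equals 1 / (x (x - 1)) - 2 ln (x - 1) / x^2. From 4 on, ln (x - 1) >= 1
  makes the second term dominate.\<close>

lemma gap_antimono_real:
  assumes "4 \<le> a" "a \<le> b" shows "gap b \<le> gap a"
proof (rule DERIV_nonpos_imp_nonincreasing[OF assms(2)])
  fix x assume "a \<le> x" "x \<le> b"
  then have x: "4 \<le> x" using assms by simp
  let ?D = "1 / x - ((1 - 2 / x) * (1 / (x - 1)) + 2 / x\<^sup>2 * ln (x - 1))"
  have "((\<lambda>x. ln x - (1 - 2 / x) * ln (x - 1)) has_real_derivative ?D) (at x)"
    using x by (auto intro!: derivative_eq_intros simp: power2_eq_square)
  then have "(gap has_real_derivative ?D) (at x)"
    unfolding gap_def[abs_def] loss_def .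
  moreover have "?D \<le> 0"
  proof -
    have "1 \<le> ln (x - 1)" using ln_ge_1 x by simp
    then have "2 / x\<^sup>2 * 1 \<le> 2 / x\<^sup>2 * ln (x - 1)" by (intro mult_left_mono) auto
    moreover have "1 / x - (1 - 2 / x) * (1 / (x - 1)) = 1 / (x * (x - 1))"
      using x by (simp add: field_simps)
    moreover have "1 / (x * (x - 1)) \<le> 2 / x\<^sup>2"
      using x by (simp add: field_simps power2_eq_square)
    ultimately show ?thesis by linarith
  qed
  ultimately show "\<exists>y. (gap has_real_derivative y) (at x) \<and> y \<le> 0" by blast
qed

lemma ln_power_le: "(a::real) ^ m \<le> b ^ n \<Longrightarrow> 0 < a \<Longrightarrow> 0 < b \<Longrightarrow> m * ln a \<le> n * ln b"
  by (metis ln_le_cancel_iff ln_realpow zero_less_power)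

text \<open>On the reals \<open>gap\<close> is still increasing at \<open>3\<close>, so this step of the integer monotonicity is numeric.\<close>

lemma gap_4_le_3: "gap 4 \<le> gap 3"
proof -
  \<comment> \<open>The claim is equivalent to this, and 2^14 = 16384 <= 19683 = 3^9.\<close>
  have "14 * ln (2::real) \<le> 9 * ln 3" using ln_power_le[of 2 14 3 9] by simp
  moreover have "ln (4::real) = 2 * ln 2" using ln_realpow[of 2 2] by simp
  ultimately show ?thesis unfolding gap_def loss_def by simp
qed

lemma gap_antimono:
  fixes a b :: nat assumes "3 \<le> a" "a \<le> b" shows "gap b \<le> gap a"
proof (cases "a = 3")
  case True
  show ?thesis
  proof (cases "b = 3")
    case False
    then have "gap b \<le> gap 4" using assms by (intro gap_antimono_real) auto
    then show ?thesis using True gap_4_le_3 by simp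
  qed (use True in simp)
qed (use assms in \<open>auto intro: gap_antimono_real\<close>)

context centered_pair
begin

text \<open>By monotonicity the worst case has all sizes equal to the lower bound \<open>P\<close>,
  which leaves one inequality between \<open>r\<close> and the excess
  \<open>card I - r\<close>.\<close>

lemma loss_gap_min:
  assumes P: "3 \<le> P" "\<And>i. i \<in> I \<Longrightarrow> P \<le> p i"
  shows "real (card I - r) * loss P \<le> r * gap P"
proof -
  obtain R where R: "R \<subseteq> I" "card R = r" using rle obtain_subset_with_card_n by metis
  have cIR: "card (I - R) = card I - r" using R finI by (simp add: card_Diff_subset finite_subset)
  have "real (card I - r) * loss P = (\<Sum>i\<in>I - R. loss P)" using cIR by simp
  also have "\<dots> \<le> (\<Sum>i\<in>I - R. loss (p i))"
    using P by (intro sum_mono loss_mono) auto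
  also have "\<dots> \<le> (\<Sum>i\<in>R. gap (p i))" by (rule sum_loss_le[OF R])
  also have "\<dots> \<le> (\<Sum>i\<in>R. gap P)" using P R by (intro sum_mono gap_antimono) auto
  finally show ?thesis using R by simp
qed

end

lemma centered_pair_exists:
  assumes mx: "max_cross I p r A B" and I: "finite I" "r \<le> card I" "\<forall>i\<in>I. 3 \<le> p i"
    and rel: "\<forall>i\<in>I. \<not> irrelevant p A i \<and> \<not> irrelevant p B i"
  obtains z where "centered_pair I p r A B z"
proof -
  define Q where "Q i z \<longleftrightarrow> z \<in> {1..p i} \<and> (\<forall>v. v \<noteq> z \<longrightarrow>
      real (p i) * (real (p i) - 1) * card {x\<in>A. x i = v} \<le> card A \<and>
      real (p i) * (real (p i) - 1) * card {y\<in>B. y i = v} \<le> card B)" for i z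
  have "\<exists>z. Q i z" if i: "i \<in> I" for i
  proof -
    have "\<not> irrelevant p B i" using rel i by blast
    then show ?thesis
    proof (rule max_cross_dominant_value[OF mx I i])
      fix z assume "z \<in> {1..p i}"
        "\<And>v. v \<noteq> z \<Longrightarrow> real (p i) * (real (p i) - 1) * card {x\<in>A. x i = v} \<le> card A"
        "\<And>v. v \<noteq> z \<Longrightarrow> real (p i) * (real (p i) - 1) * card {y\<in>B. y i = v} \<le> card B"
      then have "Q i z" unfolding Q_def by blast
      then show "\<exists>z. Q i z" by blast
    qed
  qed
  then obtain z where z: "Q i (z i)" if "i \<in> I" for i by metis
  have "centered_pair I p r A B (restrict z I)"
  proof (rule centered_pair.intro)
    show "restrict z I \<in> cube I p" using z unfolding Q_def cube_def by auto
  qed (use mx I z in \<open>auto simp: Q_def\<close>)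
  then show ?thesis using that by blast
qed

section \<open>Counting vectors of small support\<close>

text \<open>The elementary symmetric polynomial of degree \<open>k\<close> in the numbers
  \<open>f i\<close>. For \<open>f i = p i - 1\<close> it counts the vectors that leave
  \<open>z\<close> exactly on some k-subset of \<open>J\<close>.\<close>

definition esym :: "('i \<Rightarrow> nat) \<Rightarrow> 'i set \<Rightarrow> nat \<Rightarrow> nat" where
  "esym f J k = (\<Sum>U | U \<subseteq> J \<and> card U = k. \<Prod>i\<in>U. f i)"

lemma esym_0: "finite J \<Longrightarrow> esym f J 0 = 1"
proof -
  assume "finite J"
  then have "{U. U \<subseteq> J \<and> card U = 0} = {{}}" by (auto simp: finite_subset)
  then show ?thesis unfolding esym_def by simp
qed

lemma esym_1: "finite J \<Longrightarrow> esym f J 1 = sum f J"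
proof -
  assume "finite J"
  have "{U. U \<subseteq> J \<and> card U = 1} = (\<lambda>i. {i}) ` J" by (auto simp: card_1_singleton_iff)
  then show ?thesis unfolding esym_def by (simp add: sum.reindex)
qed

lemma esym_insert:
  assumes "finite J" "i \<notin> J"
  shows "esym f (insert i J) (Suc k) = esym f J (Suc k) + f i * esym f J k"
proof -
  let ?S = "\<lambda>k. {U. U \<subseteq> J \<and> card U = k}"
  have fin: "finite (?S k)" for k using assms(1) by simp
  have finU: "finite U" if "U \<subseteq> J" for U using that assms(1) finite_subset by blast
  have eq: "{U. U \<subseteq> insert i J \<and> card U = Suc k} = ?S (Suc k) \<union> insert i ` ?S k" (is "?L = ?R")
  proof (intro equalityI subsetI)
    fix U assume U: "U \<in> ?L"
    show "U \<in> ?R"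
    proof (cases "i \<in> U")
      case True
      then have "U = insert i (U - {i})" by blast
      moreover have "U - {i} \<in> ?S k" using U True assms(1) by (auto simp: finite_subset)
      ultimately show ?thesis by blast
    next
      case False then show ?thesis using U by blast
    qed
  next
    fix U assume "U \<in> ?R"
    then show "U \<in> ?L" using assms(2) finU by (auto simp: subset_iff card_insert_if)
  qed
  have inj: "inj_on (insert i) (?S k)" using assms(2) by (intro inj_onI) (metis CollectD insert_ident subsetD)
  have "esym f (insert i J) (Suc k)
      = (\<Sum>U\<in>?S (Suc k). \<Prod>i\<in>U. f i) + (\<Sum>U\<in>insert i ` ?S k. \<Prod>i\<in>U. f i)"
    unfolding esym_def eq using fin assms(2) by (intro sum.union_disjoint) auto
  also have "(\<Sum>U\<in>insert i ` ?S k. \<Prod>i\<in>U. f i) = (\<Sum>U\<in>?S k. f i * (\<Prod>i\<in>U. f i))"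
    unfolding sum.reindex[OF inj] using assms(2) finU by (intro sum.cong) (auto intro!: prod.insert)
  finally show ?thesis unfolding esym_def by (simp add: sum_distrib_left)
qed

text \<open>Double counting of pairs (U, i) with i in U and |U| = k + 1: removing i leaves a k-set
  and a factor \<open>f i \<le> M\<close>, and each k-set arises from \<open>card J - k\<close>
  choices of i.\<close>

lemma esym_Suc_le:
  assumes J: "finite J" and M: "\<And>i. i \<in> J \<Longrightarrow> f i \<le> M"
  shows "Suc k * esym f J (Suc k) \<le> (card J - k) * M * esym f J k"
proof -
  let ?S = "\<lambda>k. {U. U \<subseteq> J \<and> card U = k}"
  have fin: "finite (?S k)" for k using J by simp
  have finU: "finite U" if "U \<subseteq> J" for U using that J finite_subset by blast
  have "Suc k * esym f J (Suc k) = (\<Sum>U\<in>?S (Suc k). \<Sum>i\<in>U. \<Prod>j\<in>U. f j)"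
    unfolding esym_def by (simp add: sum_distrib_left)
  also have "\<dots> = (\<Sum>(U, i)\<in>(SIGMA U:?S (Suc k). U). \<Prod>j\<in>U. f j)"
    using fin finU by (intro sum.Sigma) auto
  also have "\<dots> = (\<Sum>(U, i)\<in>(SIGMA U:?S k. J - U). f i * (\<Prod>j\<in>U. f j))"
  proof (rule sum.reindex_bij_witness[where i = "\<lambda>(U, i). (insert i U, i)" and j = "\<lambda>(U, i). (U - {i}, i)"])
    fix a assume "a \<in> (SIGMA U:?S (Suc k). U)"
    then obtain U i where a: "a = (U, i)" "U \<subseteq> J" "card U = Suc k" "i \<in> U" by auto
    then show "(case case a of (U, i) \<Rightarrow> (U - {i}, i) of (U, i) \<Rightarrow> (insert i U, i)) = a" by auto
    show "(case a of (U, i) \<Rightarrow> (U - {i}, i)) \<in> (SIGMA U:?S k. J - U)"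
      using a finU[of U] by auto
    show "(case case a of (U, i) \<Rightarrow> (U - {i}, i) of (U, i) \<Rightarrow> f i * prod f U) = (case a of (U, i) \<Rightarrow> prod f U)"
      using a finU[of U] by (simp add: prod.remove)
  next
    fix b assume "b \<in> (SIGMA U:?S k. J - U)"
    then obtain U i where b: "b = (U, i)" "U \<subseteq> J" "card U = k" "i \<in> J" "i \<notin> U" by auto
    then show "(case case b of (U, i) \<Rightarrow> (insert i U, i) of (U, i) \<Rightarrow> (U - {i}, i)) = b" by auto
    show "(case b of (U, i) \<Rightarrow> (insert i U, i)) \<in> (SIGMA U:?S (Suc k). U)"
      using b finU[of U] by auto
  qed
  also have "\<dots> = (\<Sum>U\<in>?S k. \<Sum>i\<in>J - U. f i * (\<Prod>j\<in>U. f j))"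
    using fin J by (intro sum.Sigma[symmetric]) auto
  also have "\<dots> \<le> (\<Sum>U\<in>?S k. (card J - k) * M * (\<Prod>j\<in>U. f j))"
  proof (rule sum_mono)
    fix U assume U: "U \<in> ?S k"
    then have c: "card (J - U) = card J - k" using finU by (auto simp: card_Diff_subset)
    have "(\<Sum>i\<in>J - U. f i * (\<Prod>j\<in>U. f j)) \<le> (\<Sum>i\<in>J - U. M * (\<Prod>j\<in>U. f j))"
      using M by (intro sum_mono mult_right_mono) auto
    then show "(\<Sum>i\<in>J - U. f i * (\<Prod>j\<in>U. f j)) \<le> (card J - k) * M * (\<Prod>j\<in>U. f j)"
      using c by simp
  qed
  finally show ?thesis unfolding esym_def by (simp add: sum_distrib_left)
qed

lemma esym_const:
  assumes "finite J" "\<And>i. i \<in> J \<Longrightarrow> f i = c"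
  shows "esym f J k = (card J choose k) * c ^ k"
proof -
  have "esym f J k = (\<Sum>U | U \<subseteq> J \<and> card U = k. c ^ k)"
    unfolding esym_def
  proof (intro sum.cong refl)
    fix U assume U: "U \<in> {U. U \<subseteq> J \<and> card U = k}"
    then have "(\<Prod>i\<in>U. f i) = (\<Prod>i\<in>U. c)" using assms(2) by (intro prod.cong) auto
    also have "\<dots> = c ^ k" using U by simp
    finally show "(\<Prod>i\<in>U. f i) = c ^ k" .
  qed
  then show ?thesis using n_subsets[OF assms(1)] by simp
qed

text \<open>A product over a k-set is padded by s - k further sizes, each at least \<open>P\<close>,
  to a product over an s-set, which \<open>X\<close> bounds. This trades unknown sizes for
  \<open>P\<close> at the price of the common factor \<open>X\<close>.\<close>

lemma esym_le:
  assumes J: "finite J" and s: "k \<le> s" "s \<le> card J"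
    and f: "\<And>i. i \<in> J \<Longrightarrow> f i \<le> p i" "\<And>i. i \<in> J \<Longrightarrow> P \<le> p i"
    and X: "\<And>U. U \<subseteq> J \<Longrightarrow> card U = s \<Longrightarrow> (\<Prod>i\<in>U. p i) \<le> X"
  shows "P ^ s * esym f J k \<le> X * ((card J choose k) * P ^ k)"
proof -
  have "P ^ (s - k) * (\<Prod>i\<in>U. f i) \<le> X" if U: "U \<subseteq> J" "card U = k" for U
  proof -
    have finU: "finite U" using U J finite_subset by blast
    have "s - k \<le> card (J - U)" using U finU s by (simp add: card_Diff_subset)
    then obtain V where V: "V \<subseteq> J - U" "card V = s - k" by (meson obtain_subset_with_card_n)
    have finV: "finite V" using V J finite_subset by blast
    have "P ^ (s - k) * (\<Prod>i\<in>U. f i) = (\<Prod>i\<in>V. P) * (\<Prod>i\<in>U. f i)" using V by simp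
    also have "\<dots> \<le> (\<Prod>i\<in>V. p i) * (\<Prod>i\<in>U. p i)"
      using f U V by (intro mult_mono prod_mono) auto
    also have "\<dots> = (\<Prod>i\<in>V \<union> U. p i)" using V finU finV by (intro prod.union_disjoint[symmetric]) auto
    also have "\<dots> \<le> X"
    proof (rule X)
      show "V \<union> U \<subseteq> J" using U V by blast
      have "card (V \<union> U) = card V + card U" using V finU finV by (intro card_Un_disjoint) auto
      then show "card (V \<union> U) = s" using U V s by simp
    qed
    finally show ?thesis .
  qed
  then have "(\<Sum>U | U \<subseteq> J \<and> card U = k. P ^ (s - k) * (\<Prod>i\<in>U. f i)) \<le> (card J choose k) * X"
    using sum_bounded_above[of "{U. U \<subseteq> J \<and> card U = k}" "\<lambda>U. P ^ (s - k) * (\<Prod>i\<in>U. f i)" X]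
      n_subsets[OF J, of k] by simp
  then have "P ^ (s - k) * esym f J k \<le> (card J choose k) * X"
    unfolding esym_def by (simp add: sum_distrib_left)
  then have "P ^ k * (P ^ (s - k) * esym f J k) \<le> P ^ k * ((card J choose k) * X)"
    by (rule mult_left_mono) simp
  also have "P ^ k * (P ^ (s - k) * esym f J k) = P ^ s * esym f J k"
    using s by (simp flip: power_add mult.assoc)
  also have "P ^ k * ((card J choose k) * X) = X * ((card J choose k) * P ^ k)"
    by (simp only: mult_ac)
  finally show ?thesis .
qed

text \<open>The size of a Hamming ball of radius \<open>k\<close> in \<open>m\<close> coordinates
  with P + 1 values each. It is applied with \<open>P\<close> a lower bound for the sizes, so it is
  slightly generous.\<close>

definition vol :: "nat \<Rightarrow> nat \<Rightarrow> nat \<Rightarrow> nat" where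
  "vol m P k = (\<Sum>j\<le>k. (m choose j) * P ^ j)"

section \<open>Balls around the dominant vector and sizes of supports\<close>

context centered_pair
begin

definition ball :: "'i set \<Rightarrow> nat \<Rightarrow> ('i \<Rightarrow> nat) set" where
  "ball J k = {x \<in> cube I p. supp x \<subseteq> J \<and> card (supp x) \<le> k}"

lemma card_supp_eq:
  assumes U: "U \<subseteq> I"
  shows "card {x \<in> cube I p. supp x = U} = (\<Prod>i\<in>U. p i - 1)"
proof -
  have "{x \<in> cube I p. supp x = U} = PiE I (\<lambda>i. if i \<in> U then {1..p i} - {z i} else {z i})"
    (is "?L = ?R")
  proof (intro equalityI subsetI)
    fix x assume "x \<in> ?L"
    then show "x \<in> ?R" unfolding supp_def cube_def by (auto simp: PiE_iff)
  next
    fix x assume x: "x \<in> ?R"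
    then have xi: "x i \<in> (if i \<in> U then {1..p i} - {z i} else {z i})" if "i \<in> I" for i
      using that by (rule PiE_mem)
    have "x i \<in> {1..p i}" if "i \<in> I" for i using xi[OF that] z_mem[OF that] by (auto split: if_splits)
    then have "x \<in> cube I p" using x unfolding cube_def by (simp add: PiE_iff)
    moreover have "supp x = U"
    proof (intro set_eqI)
      fix i show "i \<in> supp x \<longleftrightarrow> i \<in> U"
        using xi[of i] U unfolding supp_def by (cases "i \<in> U") auto
    qed
    ultimately show "x \<in> ?L" by simp
  qed
  then have "card {x \<in> cube I p. supp x = U} = (\<Prod>i\<in>I. card (if i \<in> U then {1..p i} - {z i} else {z i}))"
    using finI by (simp add: card_PiE)
  also have "\<dots> = (\<Prod>i\<in>I. if i \<in> U then p i - 1 else 1)"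
    using z_mem by (intro prod.cong) auto
  also have "\<dots> = (\<Prod>i\<in>I \<inter> U. p i - 1)" using finI by (rule prod.inter_restrict[symmetric])
  also have "I \<inter> U = U" using U by blast
  finally show ?thesis .
qed

lemma card_ball:
  assumes J: "J \<subseteq> I"
  shows "card (ball J k) = (\<Sum>j\<le>k. esym (\<lambda>i. p i - 1) J j)"
proof -
  have finJ: "finite J" using J finI finite_subset by blast
  have "ball J k = (\<Union>U\<in>{U. U \<subseteq> J \<and> card U \<le> k}. {x \<in> cube I p. supp x = U})"
    unfolding ball_def by blast
  then have "card (ball J k) = (\<Sum>U | U \<subseteq> J \<and> card U \<le> k. card {x \<in> cube I p. supp x = U})"
    using finJ finite_cube[OF finI, of p] by (simp only:) (intro card_UN_disjoint, auto)
  also have "\<dots> = (\<Sum>U | U \<subseteq> J \<and> card U \<le> k. \<Prod>i\<in>U. p i - 1)"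
    using J by (intro sum.cong card_supp_eq) auto
  also have "{U. U \<subseteq> J \<and> card U \<le> k} = (\<Union>j\<le>k. {U. U \<subseteq> J \<and> card U = j})" by auto
  also have "(\<Sum>U\<in>(\<Union>j\<le>k. {U. U \<subseteq> J \<and> card U = j}). \<Prod>i\<in>U. p i - 1)
      = (\<Sum>j\<le>k. esym (\<lambda>i. p i - 1) J j)"
    unfolding esym_def using finJ by (intro sum.UNION_disjoint) auto
  finally show ?thesis .
qed

lemma card_ball_le:
  assumes "k \<le> s" "s \<le> card I" "\<And>i. i \<in> I \<Longrightarrow> P \<le> p i"
    and X: "\<And>U. U \<subseteq> I \<Longrightarrow> card U = s \<Longrightarrow> (\<Prod>i\<in>U. p i) \<le> X"
  shows "P ^ s * card (ball I k) \<le> X * vol (card I) P k"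
proof -
  have "P ^ s * card (ball I k) = (\<Sum>j\<le>k. P ^ s * esym (\<lambda>i. p i - 1) I j)"
    using card_ball[OF subset_refl] by (simp add: sum_distrib_left)
  also have "\<dots> \<le> (\<Sum>j\<le>k. X * ((card I choose j) * P ^ j))"
    using assms by (intro sum_mono esym_le[OF finI, where s = s and p = p]) auto
  finally show ?thesis unfolding vol_def by (simp add: sum_distrib_left)
qed

text \<open>With disjoint supports, exactly one of \<open>x i\<close>, \<open>y i\<close> equals
  \<open>z i\<close> on the whole of the union, so \<open>x\<close> and \<open>y\<close> disagree
  there.\<close>

lemma supp_add_le:
  assumes "x \<in> A" "y \<in> B" "supp x \<inter> supp y = {}"
  shows "card (supp x) + card (supp y) \<le> card I - r"
proof -
  have "r \<le> card {i\<in>I. x i = y i}" using assms cross unfolding cross_agree_def by blast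
  also have "\<dots> \<le> card (I - (supp x \<union> supp y))"
    using finI assms(3) unfolding supp_def by (intro card_mono) auto
  also have "\<dots> = card I - card (supp x \<union> supp y)"
    using supp_subset finite_supp by (intro card_Diff_subset) auto
  also have "card (supp x \<union> supp y) = card (supp x) + card (supp y)"
    using assms(3) finite_supp by (intro card_Un_disjoint) auto
  finally have "r \<le> card I - (card (supp x) + card (supp y))" .
  moreover have "card (supp x) + card (supp y) \<le> card I"
    using \<open>card (supp x \<union> supp y) = card (supp x) + card (supp y)\<close> supp_subset finI
    by (metis Un_least card_mono)
  ultimately show ?thesis by linarith
qed

lemma agree_ge:
  "card I - card (supp x) - card (supp y) \<le> card {i\<in>I. x i = y i}"
proof -
  have "card (supp x \<union> supp y) \<le> card (supp x) + card (supp y)" by (rule card_Un_le)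
  then have "card I - card (supp x) - card (supp y) \<le> card I - card (supp x \<union> supp y)" by linarith
  also have "\<dots> = card (I - (supp x \<union> supp y))"
    using supp_subset finite_supp by (intro card_Diff_subset[symmetric]) auto
  also have "\<dots> \<le> card {i\<in>I. x i = y i}"
    using finI unfolding supp_def by (intro card_mono) auto
  finally show ?thesis .
qed

text \<open>Members of \<open>B\<close> whose support misses that of \<open>x\<close> lie in the
  ball by \<open>supp_add_le\<close>. The others leave \<open>z\<close> at a place of
  \<open>supp x\<close>, and each such place accounts for at most |B| / P of them.\<close>

lemma card_le_ball:
  assumes x: "x \<in> A" and P: "\<And>i. i \<in> I \<Longrightarrow> P \<le> p i"
  shows "P * card B \<le> P * card (ball (I - supp x) (card I - r - card (supp x))) + card (supp x) * card B"
proof -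
  let ?W = "ball (I - supp x) (card I - r - card (supp x))"
  have "B \<subseteq> ?W \<union> (\<Union>i\<in>supp x. {y\<in>B. y i \<noteq> z i})"
  proof
    fix y assume y: "y \<in> B"
    show "y \<in> ?W \<union> (\<Union>i\<in>supp x. {y\<in>B. y i \<noteq> z i})"
    proof (cases "supp x \<inter> supp y = {}")
      case True
      have "y \<in> cube I p" "supp y \<subseteq> I - supp x" using y subs True supp_subset by blast+
      moreover have "card (supp y) \<le> card I - r - card (supp x)" using supp_add_le[OF x y True] by linarith
      ultimately show ?thesis unfolding ball_def by blast
    next
      case False
      then show ?thesis using y unfolding supp_def by blast
    qed
  qed
  moreover have "finite ?W" unfolding ball_def using finite_cube[OF finI] by auto
  ultimately have "card B \<le> card (?W \<union> (\<Union>i\<in>supp x. {y\<in>B. y i \<noteq> z i}))"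
    using fins finite_supp by (intro card_mono) auto
  also have "\<dots> \<le> card ?W + (\<Sum>i\<in>supp x. card {y\<in>B. y i \<noteq> z i})"
    by (rule order_trans[OF card_Un_le add_left_mono[OF card_UN_le[OF finite_supp]]])
  finally have "P * card B \<le> P * (card ?W + (\<Sum>i\<in>supp x. card {y\<in>B. y i \<noteq> z i}))"
    by (rule mult_le_mono2)
  also have "\<dots> = P * card ?W + (\<Sum>i\<in>supp x. P * card {y\<in>B. y i \<noteq> z i})"
    by (simp add: distrib_left sum_distrib_left)
  also have "(\<Sum>i\<in>supp x. P * card {y\<in>B. y i \<noteq> z i}) \<le> (\<Sum>i\<in>supp x. card B)"
  proof (rule sum_mono)
    fix i assume "i \<in> supp x"
    then have i: "i \<in> I" unfolding supp_def by simp
    have "real (p i * card {y\<in>B. y i \<noteq> z i}) \<le> real (card B)"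
      using centered_pair.off_center[OF swap i] by simp
    then have "p i * card {y\<in>B. y i \<noteq> z i} \<le> card B" by (simp only: of_nat_le_iff)
    moreover have "P * card {y\<in>B. y i \<noteq> z i} \<le> p i * card {y\<in>B. y i \<noteq> z i}"
      using P[OF i] by simp
    ultimately show "P * card {y\<in>B. y i \<noteq> z i} \<le> card B" by linarith
  qed
  finally show ?thesis by simp
qed

text \<open>Let \<open>k\<close> be the largest support size in \<open>A\<close>; then supports in
  \<open>B\<close> have size at most s - k with s = card I - r. Vectors within these two radii
  always agree in at least \<open>r\<close> places, so saturation fills both balls.\<close>

lemma balls_if_supp_le:
  assumes "\<And>x y. x \<in> A \<Longrightarrow> y \<in> B \<Longrightarrow> card (supp x) + card (supp y) \<le> card I - r"
  obtains k where "k \<le> card I - r" "A = ball I k" "B = ball I (card I - r - k)"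
proof -
  define k where "k = Max (card ` supp ` A)"
  have ne: "A \<noteq> {}" "B \<noteq> {}" using cards_pos by auto
  have fin: "finite (card ` supp ` A)" using fins by simp
  have "k \<in> card ` supp ` A" unfolding k_def using fin ne by (intro Max_in) auto
  then obtain x0 where x0: "x0 \<in> A" "card (supp x0) = k" by auto
  have A: "card (supp x) \<le> k" if "x \<in> A" for x unfolding k_def using fin that by (intro Max_ge) auto
  have B: "k + card (supp y) \<le> card I - r" if "y \<in> B" for y using assms[OF x0(1) that] x0(2) by simp
  have k: "k \<le> card I - r" using B ne by (meson add_leD1 all_not_in_conv)
  show ?thesis
  proof (rule that[OF k])
    show "A = ball I k"
    proof (intro equalityI subsetI)
      fix x assume "x \<in> A" then show "x \<in> ball I k"
        using A subs supp_subset unfolding ball_def by blast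
    next
      fix x assume x: "x \<in> ball I k"
      show "x \<in> A"
      proof (rule max_cross_closed[OF mx finI rle p_ge_1])
        show "x \<in> cube I p" using x unfolding ball_def by blast
        fix y assume "y \<in> B"
        then have "r \<le> card I - card (supp x) - card (supp y)"
          using B x rle unfolding ball_def by fastforce
        then show "r \<le> card {i\<in>I. x i = y i}" using agree_ge le_trans by blast
      qed
    qed
    show "B = ball I (card I - r - k)"
    proof (intro equalityI subsetI)
      fix y assume "y \<in> B"
      then have "y \<in> cube I p" "card (supp y) \<le> card I - r - k" using B[of y] subs by auto
      then show "y \<in> ball I (card I - r - k)" using supp_subset unfolding ball_def by blast
    next
      fix y assume y: "y \<in> ball I (card I - r - k)"
      show "y \<in> B"
      proof (rule max_cross_closed[OF max_cross_sym[OF mx] finI rle p_ge_1])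
        show "y \<in> cube I p" using y unfolding ball_def by blast
        fix x assume "x \<in> A"
        then have "card (supp x) \<le> k" by (rule A)
        moreover have "card (supp y) \<le> card I - r - k" using y unfolding ball_def by blast
        ultimately have "r \<le> card I - card (supp y) - card (supp x)" using k rle by linarith
        then show "r \<le> card {i\<in>I. y i = x i}" using agree_ge le_trans by blast
      qed
    qed
  qed
qed

text \<open>\<open>X\<close> is the largest such product, and the subcube leaving a maximizing s-set
  free is the competitor.\<close>

lemma max_prod:
  assumes "s = card I - r"
  obtains X where "X > 0" "X\<^sup>2 \<le> card A * card B"
    "\<And>U. U \<subseteq> I \<Longrightarrow> card U = s \<Longrightarrow> (\<Prod>i\<in>U. p i) \<le> X"
proof -
  define F where "F = (\<lambda>U. \<Prod>i\<in>U. p i) ` {U. U \<subseteq> I \<and> card U = s}"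
  have fin: "finite F" unfolding F_def using finI by simp
  obtain U where U: "U \<subseteq> I" "card U = s" using assms by (meson diff_le_self obtain_subset_with_card_n)
  then have "F \<noteq> {}" unfolding F_def by auto
  then have "Max F \<in> F" using fin by (intro Max_in)
  then obtain W where W: "W \<subseteq> I" "card W = s" "Max F = (\<Prod>i\<in>W. p i)" unfolding F_def by auto
  have "card (I - W) = r" using W assms rle finI by (simp add: card_Diff_subset finite_subset)
  from max_cross_ge[OF mx finI _ this p_ge_1] have "(\<Prod>i\<in>I - (I - W). p i)\<^sup>2 \<le> card A * card B" by blast
  moreover have "I - (I - W) = W" using W by blast
  ultimately have "(Max F)\<^sup>2 \<le> card A * card B" using W(3) by simp
  moreover have "Max F > 0" unfolding W(3) using W(1) p3 by (intro prod_pos) force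
  moreover have "(\<Prod>i\<in>U. p i) \<le> Max F" if "U \<subseteq> I" "card U = s" for U
    using fin that unfolding F_def by (intro Max_ge) auto
  ultimately show ?thesis using that by blast
qed

lemma card_le_vol:
  assumes x: "x \<in> A" and s: "s = card I - r" and P: "\<And>i. i \<in> I \<Longrightarrow> P \<le> p i"
    and X: "\<And>U. U \<subseteq> I \<Longrightarrow> card U = s \<Longrightarrow> (\<Prod>i\<in>U. p i) \<le> X"
  shows "(P - card (supp x)) * P ^ s * card B \<le> P * X * vol (card I) P (s - card (supp x))"
proof -
  let ?a = "card (supp x)"
  have "ball (I - supp x) (s - ?a) \<subseteq> ball I (s - ?a)" unfolding ball_def by blast
  then have "card (ball (I - supp x) (s - ?a)) \<le> card (ball I (s - ?a))"
    using finite_cube[OF finI] unfolding ball_def by (intro card_mono) auto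
  moreover have "P * card B \<le> P * card (ball (I - supp x) (s - ?a)) + ?a * card B"
    using card_le_ball[OF x P] s by simp
  ultimately have "P * card B \<le> P * card (ball I (s - ?a)) + ?a * card B"
    by (meson add_right_mono mult_le_mono2 order_trans)
  then have "(P - ?a) * card B \<le> P * card (ball I (s - ?a))"
    by (simp add: diff_mult_distrib)
  then have "P ^ s * ((P - ?a) * card B) \<le> P ^ s * (P * card (ball I (s - ?a)))" by simp
  also have "\<dots> = P * (P ^ s * card (ball I (s - ?a)))" by simp
  also have "\<dots> \<le> P * (X * vol (card I) P (s - ?a))"
    using s P X by (intro mult_le_mono2 card_ball_le[where s = s]) auto
  finally show ?thesis by (simp add: mult_ac)
qed

text \<open>The condition \<open>s + 1 < P * (P - 1)\<close> secures a, b <= s for the support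
  sizes. If a + b > s, multiplying the two estimates of \<open>card_le_vol\<close> and inserting X^2
  <= |A||B| leaves X^2 on both sides; cancelling it contradicts the volume hypothesis.\<close>

lemma balls_if_vol_small:
  assumes s: "s = card I - r" and P: "\<And>i. i \<in> I \<Longrightarrow> P \<le> p i" "s + 1 < P * (P - 1)"
    and vol: "\<And>a b. a \<le> s \<Longrightarrow> b \<le> s \<Longrightarrow> s < a + b \<Longrightarrow>
      P\<^sup>2 * (vol (card I) P (s - a) * vol (card I) P (s - b)) < (P - a) * (P - b) * P ^ (2 * s)"
  obtains k where "k \<le> card I - r" "A = ball I k" "B = ball I (card I - r - k)"
proof (rule balls_if_supp_le)
  have small: "card I - r + 1 < p i * (p i - 1)" if "i \<in> I" for i
  proof -
    have "P * (P - 1) \<le> p i * (p i - 1)" using P(1)[OF that] by (intro mult_le_mono) auto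
    then show ?thesis using P(2) s by linarith
  qed
  fix x y assume x: "x \<in> A" and y: "y \<in> B"
  define a b where "a = card (supp x)" and "b = card (supp y)"
  show "card (supp x) + card (supp y) \<le> card I - r"
  proof (rule ccontr)
    assume "\<not> card (supp x) + card (supp y) \<le> card I - r"
    then have ab: "s < a + b" unfolding a_def b_def s by simp
    have "a \<le> s" "b \<le> s"
      unfolding a_def b_def s using card_supp_le[OF x] centered_pair.card_supp_le[OF swap y]
        small by blast+
    note V = vol[OF this ab]
    obtain X where X: "X > 0" "X\<^sup>2 \<le> card A * card B"
      "\<And>U. U \<subseteq> I \<Longrightarrow> card U = s \<Longrightarrow> (\<Prod>i\<in>U. p i) \<le> X" using max_prod[OF s] by blast
    have B: "(P - a) * P ^ s * card B \<le> P * X * vol (card I) P (s - a)"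
      unfolding a_def using card_le_vol[OF x s P(1) X(3)] by blast
    have A: "(P - b) * P ^ s * card A \<le> P * X * vol (card I) P (s - b)"
      unfolding b_def using centered_pair.card_le_vol[OF swap y s P(1) X(3)] by blast
    have "((P - a) * (P - b) * P ^ (2 * s)) * X\<^sup>2 \<le> ((P - a) * (P - b) * P ^ (2 * s)) * (card A * card B)"
      using X(2) by (rule mult_le_mono2)
    also have "\<dots> = ((P - a) * P ^ s * card B) * ((P - b) * P ^ s * card A)"
      unfolding mult_2 power_add by (simp only: mult_ac)
    also have "\<dots> \<le> (P * X * vol (card I) P (s - a)) * (P * X * vol (card I) P (s - b))"
      using A B by (rule mult_le_mono[rotated])
    also have "\<dots> = (P\<^sup>2 * (vol (card I) P (s - a) * vol (card I) P (s - b))) * X\<^sup>2"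
      by (simp add: power2_eq_square mult_ac)
    finally show False using V X(1) by simp
  qed
qed (use that in blast)

end

section \<open>Excluding radii above 1\<close>

context centered_pair
begin

lemma ball_0: "ball I 0 = {z}"
proof -
  have "x = z" if "x \<in> cube I p" "supp x = {}" for x
    using that z by (intro cube_eqI) (auto simp: supp_def)
  moreover have "supp z = {}" unfolding supp_def by simp
  ultimately show ?thesis unfolding ball_def using z finite_supp by auto
qed

lemma card_ball_1: "card (ball I 1) = 1 + (\<Sum>i\<in>I. p i - 1)"
proof -
  have "card (ball I 1) = esym (\<lambda>i. p i - 1) I 0 + esym (\<lambda>i. p i - 1) I 1"
    by (simp add: card_ball)
  then show ?thesis using finI esym_0[of I] esym_1[of I] by simp
qed

lemma obtain_max_coord:
  assumes "J \<subseteq> I" "J \<noteq> {}"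
  obtains i where "i \<in> J" "\<And>j. j \<in> J \<Longrightarrow> p j \<le> p i"
proof -
  have fin: "finite J" using assms(1) finI finite_subset by blast
  then have "Max (p ` J) \<in> p ` J" using assms(2) by (intro Max_in) auto
  then obtain i where "i \<in> J" "p i = Max (p ` J)" by auto
  then show ?thesis using that fin by (metis Max_ge finite_imageI imageI)
qed

text \<open>A large ball leaves \<open>z i\<close> too often. Take \<open>i\<close> of maximal size,
  M = p i - 1, k = l + 1, and let W be the ball of radius l on the other coordinates, E its next
  layer. Then M W members leave \<open>z i\<close>, so \<open>off_center\<close> gives M^2 W <= W +
  E, while \<open>esym_Suc_le\<close> bounds E by (m - 1 - l) M W / (l + 1). For m <= 2M and l >= 1
  these are incompatible.\<close>

lemma ball_radius_le_1:
  assumes A: "A = ball I k" and k: "k \<le> card I"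
    and big: "\<And>i. i \<in> I \<Longrightarrow> card I + 2 \<le> 2 * p i"
  shows "k \<le> 1"
proof (rule ccontr)
  assume "\<not> k \<le> 1"
  then obtain l where l: "k = Suc l" "1 \<le> l" by (cases k) auto
  have "I \<noteq> {}" using k l by auto
  then obtain i where i: "i \<in> I" and max: "\<And>j. j \<in> I \<Longrightarrow> p j \<le> p i"
    using obtain_max_coord[OF subset_refl] by metis
  define J f M where "J = I - {i}" and "f = (\<lambda>j. p j - 1)" and "M = p i - 1"
  define W E where "W = (\<Sum>j\<le>l. esym f J j)" and "E = esym f J (Suc l)"
  have J: "finite J" "i \<notin> J" "J \<subseteq> I" "insert i J = I" "card J = card I - 1"
    using finI i unfolding J_def by auto
  have M: "p i = M + 1" "2 \<le> M" using p3[OF i] unfolding M_def by auto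
  have cJ: "card (ball J k) = W + E" unfolding card_ball[OF J(3)] l W_def E_def f_def by simp
  have "card A = (\<Sum>j\<le>Suc l. esym f I j)" unfolding A card_ball[OF subset_refl] l f_def ..
  also have "\<dots> = esym f I 0 + (\<Sum>j\<le>l. esym f I (Suc j))" by (rule sum.atMost_Suc_shift)
  also have "\<dots> = esym f J 0 + (\<Sum>j\<le>l. esym f J (Suc j) + M * esym f J j)"
  proof -
    have "esym f I (Suc j) = esym f J (Suc j) + M * esym f J j" for j
      using esym_insert[OF J(1,2), of f j] unfolding J(4) f_def M_def .
    then show ?thesis by (simp add: esym_0[OF finI] esym_0[OF J(1)])
  qed
  also have "\<dots> = (\<Sum>j\<le>Suc l. esym f J j) + M * W"
    unfolding W_def sum.atMost_Suc_shift[of _ l] by (simp add: sum.distrib sum_distrib_left)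
  also have "\<dots> = W + E + M * W" unfolding W_def E_def by simp
  finally have cA: "card A = W + E + M * W" .
  have "{x\<in>A. x i = z i} = ball J k"
    unfolding A ball_def J_def supp_def using i by auto
  moreover have "{x\<in>A. x i \<noteq> z i} = A - {x\<in>A. x i = z i}" by blast
  ultimately have "card {x\<in>A. x i \<noteq> z i} = card A - card (ball J k)"
    using fins by (metis (no_types, lifting) card_Diff_subset finite_subset mem_Collect_eq subsetI)
  then have "card {x\<in>A. x i \<noteq> z i} = M * W" using cA cJ by simp
  then have "real (p i * (M * W)) \<le> real (card A)" using off_center[OF i] by simp
  then have "p i * (M * W) \<le> card A" by (simp only: of_nat_le_iff)
  then have 1: "M * M * W \<le> W + E" unfolding cA M(1) by (simp add: algebra_simps)
  have "esym f J l \<le> W" unfolding W_def by (rule member_le_sum) auto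
  then have "Suc l * E \<le> (card J - l) * M * W"
    using esym_Suc_le[OF J(1), of f M l] max J(3) unfolding E_def M_def f_def
    by (meson diff_le_mono dual_order.trans mult_le_mono2 subsetD)
  then have 2: "Suc l * E \<le> (card I - 1 - l) * M * W" unfolding J(5) .
  have "esym f J 0 \<le> W" unfolding W_def by (rule member_le_sum) auto
  then have W: "W > 0" using esym_0[OF J(1), of f] by simp
  have "Suc l * (M * M * W) \<le> Suc l * (W + E)" using 1 by (rule mult_le_mono2)
  also have "\<dots> \<le> Suc l * W + (card I - 1 - l) * M * W" using 2 by (simp add: distrib_left)
  finally have "Suc l * (M * M) * W \<le> (Suc l + (card I - 1 - l) * M) * W" by (simp add: algebra_simps)
  then have 3: "Suc l * (M * M) \<le> Suc l + (card I - 1 - l) * M"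
    by (rule mult_right_le_imp_le) (fact W)
  have "card I \<le> 2 * M" using big[OF i] M by simp
  then have "(card I - 1 - l) * M \<le> (2 * M - 2) * M" using l by (intro mult_le_mono1) simp
  then have "Suc l * (M * M) \<le> Suc l + (2 * M - 2) * M" using 3 by linarith
  moreover obtain u where u: "M = u + 2" using M by (metis add.commute le_Suc_ex)
  moreover obtain v where v: "l = v + 1" using l by (metis add.commute le_Suc_ex)
  ultimately show False by (simp add: algebra_simps)
qed

text \<open>Both radii are at most 1 and add up to s, so s <= 2. Comparing with the subcube that
  leaves the s largest coordinates free excludes s = 1 and forces equal sizes for s = 2.\<close>

lemma balls_structure:
  assumes AB: "A = ball I k" "B = ball I (s - k)" and k: "k \<le> s" and s: "s = card I - r"
    and p: "\<And>i. i \<in> I \<Longrightarrow> r + 1 \<le> p i" and big: "\<And>i. i \<in> I \<Longrightarrow> card I + 2 \<le> 2 * p i"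
  shows "card I = r \<and> A = {z} \<and> B = {z} \<or>
    card I = r + 2 \<and> (\<forall>i\<in>I. p i = r + 1) \<and> A = ball I 1 \<and> B = ball I 1"
proof -
  define N where "N = 1 + (\<Sum>i\<in>I. p i - 1)"
  have "k \<le> 1" using k s by (intro ball_radius_le_1[OF AB(1)] big) auto
  moreover have "s - k \<le> 1" using s by (intro centered_pair.ball_radius_le_1[OF swap AB(2)] big) auto
  ultimately consider "s = 0" "k = 0" | "s = 1" "k \<le> 1" | "s = 2" "k = 1" using k by linarith
  then show ?thesis
  proof cases
    case 1
    then show ?thesis using AB s rle ball_0 by simp
  next
    case 2
    then have "card A * card B = N"
      unfolding AB N_def by (cases k) (auto simp: ball_0 card_ball_1[unfolded One_nat_def])
    have cI: "card I = r + 1" using 2 s by simp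
    then have "I \<noteq> {}" by auto
    then obtain i where i: "i \<in> I" and max: "\<And>j. j \<in> I \<Longrightarrow> p j \<le> p i"
      using obtain_max_coord[OF subset_refl] by metis
    have "card (I - {i}) = r" using i cI by simp
    \<comment> \<open>A point and a ball of radius 1 have product at most 1 + p i (p i - 1), less
      than (p i)^2.\<close>
    from max_cross_ge[OF mx finI _ this p_ge_1] have "(p i)\<^sup>2 \<le> N"
      using i \<open>card A * card B = N\<close> by (simp add: double_diff)
    also have "(\<Sum>j\<in>I. p j - 1) \<le> (\<Sum>j\<in>I. p i - 1)" using max by (intro sum_mono diff_le_mono)
    then have "N \<le> 1 + (r + 1) * (p i - 1)" unfolding N_def using cI by simp
    also have "\<dots> \<le> 1 + p i * (p i - 1)" using p[OF i] by (intro add_left_mono mult_le_mono1)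
    finally have "(p i)\<^sup>2 \<le> 1 + p i * (p i - 1)" .
    moreover obtain u where "p i = u + 3" using p3[OF i] by (metis add.commute le_Suc_ex)
    ultimately show ?thesis by (simp add: power2_eq_square algebra_simps)
  next
    case 3
    then have AB1: "A = ball I 1" "B = ball I 1" using AB by auto
    then have cAB: "card A * card B = N\<^sup>2" unfolding N_def by (simp only: card_ball_1 power2_eq_square)
    have cI: "card I = r + 2" using 3 s by simp
    then have "I \<noteq> {}" by auto
    then obtain i where i: "i \<in> I" and maxi: "\<And>j. j \<in> I \<Longrightarrow> p j \<le> p i"
      using obtain_max_coord[OF subset_refl] by metis
    have cIi: "card (I - {i}) = r + 1" using i cI by simp
    then have "I - {i} \<noteq> {}" by (metis card.empty add_is_0 one_neq_zero)
    then obtain j where j: "j \<in> I - {i}" and maxj: "\<And>l. l \<in> I - {i} \<Longrightarrow> p l \<le> p j"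
      using obtain_max_coord[OF Diff_subset] by metis
    have ij: "{i, j} \<subseteq> I" "i \<noteq> j" using i j by auto
    have "card (I - {i, j}) = r" using ij cI by (simp add: card_Diff_subset)
    \<comment> \<open>With i and j the two largest coordinates this becomes p i p j <= p i + (r +
      1)(p j - 1), hence p i <= r + 1.\<close>
    from max_cross_ge[OF mx finI _ this p_ge_1] have "(p i * p j)\<^sup>2 \<le> N\<^sup>2"
      using ij cAB by (simp add: double_diff)
    then have "p i * p j \<le> N" by (rule power2_le_imp_le) simp
    also have "N = p i + (\<Sum>l\<in>I - {i}. p l - 1)"
      unfolding N_def using i p3[OF i] finI by (simp add: sum.remove)
    also have "(\<Sum>l\<in>I - {i}. p l - 1) \<le> (\<Sum>l\<in>I - {i}. p j - 1)"
      using maxj by (intro sum_mono diff_le_mono)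
    also have "\<dots> = (r + 1) * (p j - 1)" using cIi by simp
    finally have "p i * p j \<le> p i + (r + 1) * (p j - 1)" by simp
    moreover obtain u where u: "p j = u + 3" using p3 j by (metis DiffD1 add.commute le_Suc_ex)
    ultimately have "p i * (u + 2) \<le> (r + 1) * (u + 2)" by (simp add: algebra_simps)
    then have "p i \<le> r + 1" by (metis add_2_eq_Suc' mult_le_cancel2 zero_less_Suc)
    then have "\<forall>l\<in>I. p l = r + 1" using maxi p by (meson le_antisym order_trans)
    then show ?thesis using cI AB1 by blast
  qed
qed

end

section \<open>Numerical estimates\<close>

lemma vol_0: "vol m P 0 = 1"
  unfolding vol_def by simp

lemma vol_1: "vol m P 1 = 1 + m * P"
  unfolding vol_def by simp

lemma vol_2: "vol m P 2 = 1 + m * P + (m choose 2) * P\<^sup>2"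
  unfolding vol_def by (simp add: numeral_2_eq_2)

lemma choose_two_le: "2 * (m choose 2) \<le> m * m"
proof -
  have "2 * (m choose 2) = m * (m - 1)" using choose_two[of m] by (cases m) auto
  then show ?thesis by simp
qed

text \<open>\<open>m + 1 \<le> P + s\<close> encodes r + 1 <= P. For s = P = 3 the right side
  vanishes as soon as a or b is 3, so that case has to stay out.\<close>

lemma vol_small_close:
  assumes P: "3 \<le> P" "s \<le> 3" "s \<le> 2 \<or> 4 \<le> P" and m: "m + 1 \<le> P + s"
    and ab: "a \<le> s" "b \<le> s" "s < a + b"
  shows "P\<^sup>2 * (vol m P (s - a) * vol m P (s - b)) < (P - a) * (P - b) * P ^ (2 * s)"
proof -
  have mP: "m * P \<le> (P + s - 1) * P" using m by (intro mult_le_mono1) simp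
  \<comment> \<open>After cancelling P^2 and assuming a <= b by symmetry, seven triples (s, a, b)
    are left.\<close>
  have main: "vol m P (s - a) * vol m P (s - b) < (P - a) * (P - b) * P ^ (2 * s - 2)"
    if ab: "a \<le> b" "b \<le> s" "s < a + b" for a b
  proof -
    have "s = 1 \<or> s = 2 \<or> s = 3" "a = 1 \<or> a = 2 \<or> a = 3" "b = 1 \<or> b = 2 \<or> b = 3"
      using P(2) ab by linarith+
    then consider "s = 1" "a = 1" "b = 1" | "s = 2" "a = 1" "b = 2" | "s = 2" "a = 2" "b = 2"
      | "s = 3" "a = 1" "b = 3" | "s = 3" "a = 2" "b = 2" | "s = 3" "a = 2" "b = 3"
      | "s = 3" "a = 3" "b = 3"
      using ab by (elim disjE) simp_all
    note c = this
    obtain u where u: "P = u + 3" using P(1) by (metis add.commute le_Suc_ex)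
    have w: "\<exists>w. P = w + 4" if "s = 3"
      using P(3) that by (intro exI[of _ "P - 4"]) auto
    have v1: "vol m P (Suc 0) = 1 + m * P" using vol_1 by simp
    have v1_le: "1 + m * P \<le> (P + 1)\<^sup>2" if "s \<le> 3"
    proof -
      have "(P + s - 1) * P \<le> (P + 2) * P" using that by (intro mult_le_mono1) simp
      then show ?thesis using mP by (simp add: power2_eq_square algebra_simps)
    qed
    show ?thesis using c
    proof cases
      case 1
      have "1 < (u + 2) * (u + 2)" by (simp add: algebra_simps)
      then show ?thesis unfolding 1 using u by (simp add: vol_0)
    next
      case 2
      have "1 + (u + 4) * (u + 3) < (u + 2) * (u + 1) * (u + 3)\<^sup>2"
        by (simp add: power2_eq_square algebra_simps)
      moreover have "m \<le> u + 4" using m 2 u by simp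
      then have "m * P \<le> (u + 4) * (u + 3)" unfolding u by (intro mult_le_mono1)
      moreover have "(P - 1) * (P - 2) * P\<^sup>2 = (u + 2) * (u + 1) * (u + 3)\<^sup>2" unfolding u by simp
      ultimately have "1 + m * P < (P - 1) * (P - 2) * P\<^sup>2" by linarith
      then show ?thesis unfolding 2 by (simp add: vol_0 v1)
    next
      case 3
      have "1 < (u + 1) * (u + 1) * (u + 3)\<^sup>2" by (simp add: power2_eq_square algebra_simps)
      then show ?thesis unfolding 3 using u by (simp add: vol_0)
    next
      case 4
      obtain w where w: "P = w + 4" using w 4 by blast
      have "m * m \<le> (P + 2) * (P + 2)" using m 4 by (intro mult_le_mono) auto
      then have "2 * (m choose 2) \<le> (P + 2) * (P + 2)" using choose_two_le[of m] by linarith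
      then have "2 * (m choose 2) * P\<^sup>2 \<le> (P + 2) * (P + 2) * P\<^sup>2" by (rule mult_le_mono1)
      moreover have "m \<le> P + 2" using m 4 by simp
      then have "m * P \<le> (P + 2) * P" by (rule mult_le_mono1)
      ultimately have "2 * (1 + m * P + (m choose 2) * P\<^sup>2)
          \<le> 2 * (1 + (P + 2) * P) + (P + 2) * (P + 2) * P\<^sup>2"
        by (simp only: distrib_left mult.assoc)
      also have "\<dots> < 2 * ((P - 1) * (P - 3) * P ^ 4)"
      proof -
        have "P - 1 = w + 3" "P - 3 = w + 1" using w by auto
        then show ?thesis
          unfolding w by (simp only:) (simp add: power4_eq_xxxx power2_eq_square algebra_simps)
      qed
      finally show ?thesis unfolding 4 by (simp add: vol_0 vol_2)
    next
      case 5
      obtain w where w: "P = w + 4" using w 5 by blast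
      have "(P + 1)\<^sup>2 < (P - 2) * P\<^sup>2" unfolding w by (simp add: power2_eq_square algebra_simps)
      then have "1 + m * P < (P - 2) * P\<^sup>2" using v1_le P(2) by linarith
      then have "(1 + m * P)\<^sup>2 < ((P - 2) * P\<^sup>2)\<^sup>2" by (rule power_strict_mono) auto
      also have "((P - 2) * P\<^sup>2)\<^sup>2 = (P - 2) * (P - 2) * P ^ 4"
        by (simp add: power_mult_distrib power2_eq_square[of "P - 2"])
      finally have "(1 + m * P) * (1 + m * P) < (P - 2) * (P - 2) * P ^ 4"
        by (simp only: power2_eq_square)
      then show ?thesis unfolding 5 by (simp add: v1)
    next
      case 6
      obtain w where w: "P = w + 4" using w 6 by blast
      have "(P + 1)\<^sup>2 < (P - 2) * (P - 3) * P ^ 4" unfolding w by (simp add: power4_eq_xxxx power2_eq_square algebra_simps)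
      then have "1 + m * P < (P - 2) * (P - 3) * P ^ 4" using v1_le P(2) by linarith
      then show ?thesis unfolding 6 by (simp add: vol_0 v1)
    next
      case 7
      obtain w where w: "P = w + 4" using w 7 by blast
      have "1 < (P - 3) * (P - 3) * P ^ 4" unfolding w by (simp add: power4_eq_xxxx algebra_simps)
      then show ?thesis unfolding 7 by (simp add: vol_0)
    qed
  qed
  have "vol m P (s - a) * vol m P (s - b) < (P - a) * (P - b) * P ^ (2 * s - 2)"
  proof (cases "a \<le> b")
    case True then show ?thesis using main ab by blast
  next
    case False
    then show ?thesis using main[of b a] ab by (simp add: mult.commute)
  qed
  then have "P\<^sup>2 * (vol m P (s - a) * vol m P (s - b)) < P\<^sup>2 * ((P - a) * (P - b) * P ^ (2 * s - 2))"
    using P(1) by simp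
  also have "\<dots> = (P - a) * (P - b) * (P\<^sup>2 * P ^ (2 * s - 2))" by (simp only: mult_ac)
  also have "P\<^sup>2 * P ^ (2 * s - 2) = P ^ (2 * s)"
  proof -
    have "2 * s = 2 + (2 * s - 2)" using ab by linarith
    then show ?thesis by (metis power_add)
  qed
  finally show ?thesis .
qed

text \<open>Crude bounds suffice here: volumes are at most 6 P^(2k), and a + b >= s + 1 keeps the
  exponent 2 + 2(s - a) + 2(s - b) at or below 2s. The constants compare as 6 * 6 < 7 * 7 <= (P -
  a)(P - b).\<close>

lemma vol_small_large:
  assumes P: "10 \<le> P" "s \<le> 3" and m: "m \<le> 3 * P" and ab: "a \<le> s" "b \<le> s" "s < a + b"
  shows "P\<^sup>2 * (vol m P (s - a) * vol m P (s - b)) < (P - a) * (P - b) * P ^ (2 * s)"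
proof -
  have vol: "vol m P k \<le> 6 * P ^ (2 * k)" if k: "k \<le> 2" for k
  proof -
    have mP: "m * P \<le> 3 * P\<^sup>2" using m by (simp add: power2_eq_square)
    have P2: "1 \<le> P\<^sup>2" using P by simp
    consider "k = 0" | "k = 1" | "k = 2" using k by linarith
    then show ?thesis
    proof cases
      case 3
      have "m * m \<le> (3 * P) * (3 * P)" using m by (intro mult_le_mono)
      then have "2 * (m choose 2) \<le> 9 * P\<^sup>2" using choose_two_le[of m] by (simp add: power2_eq_square)
      then have "2 * (m choose 2) * P\<^sup>2 \<le> 9 * P\<^sup>2 * P\<^sup>2" by (rule mult_le_mono1)
      then have 1: "2 * ((m choose 2) * P\<^sup>2) \<le> 9 * (P\<^sup>2 * P\<^sup>2)" by (simp only: mult.assoc)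
      have "100 \<le> P\<^sup>2" using power_mono[OF P(1), of 2] by simp
      then have "100 * P\<^sup>2 \<le> P\<^sup>2 * P\<^sup>2" by (rule mult_le_mono1)
      with 1 mP P2 have "1 + m * P + (m choose 2) * P\<^sup>2 \<le> 6 * (P\<^sup>2 * P\<^sup>2)"
        by (simp only: mult.assoc)
      also have "6 * (P\<^sup>2 * P\<^sup>2) = 6 * P ^ (2 * 2)" by (simp flip: power_add)
      finally show ?thesis unfolding 3 vol_2 .
    qed (use mP P2 in \<open>auto simp: vol_0 vol_1[unfolded One_nat_def]\<close>)
  qed
  have "P\<^sup>2 * (vol m P (s - a) * vol m P (s - b)) \<le> P\<^sup>2 * ((6 * P ^ (2 * (s - a))) * (6 * P ^ (2 * (s - b))))"
  proof -
    have "s - a \<le> 2" "s - b \<le> 2" using ab P by linarith+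
    then show ?thesis by (intro mult_le_mono2 mult_le_mono vol)
  qed
  also have "\<dots> = 36 * P ^ (2 + 2 * (s - a) + 2 * (s - b))"
    by (simp add: power_add power2_eq_square)
  also have "\<dots> \<le> 36 * P ^ (2 * s)"
    using P ab by (intro mult_le_mono2 power_increasing) auto
  also have "\<dots> < (P - a) * (P - b) * P ^ (2 * s)"
  proof -
    have "7 * 7 \<le> (P - a) * (P - b)" using P ab by (intro mult_le_mono) linarith+
    then have "36 < (P - a) * (P - b)" by linarith
    then show ?thesis using P by simp
  qed
  finally show ?thesis .
qed

section \<open>Comparing \<open>gap\<close> with \<open>loss\<close> to get excess at most 3\<close>

lemma gap_eq: "gap q = (ln q - ln (q - 1)) + 2 / q * ln (q - 1)"
  unfolding gap_def loss_def by (simp add: algebra_simps)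

lemma ln_diff_le:
  assumes "1 < q" shows "ln q - ln (q - 1) \<le> 1 / (q - 1 :: real)"
proof -
  have "1 + 1 / (q - 1) = q / (q - 1)" using assms by (simp add: field_simps)
  then have "ln q - ln (q - 1) = ln (1 + 1 / (q - 1))" using assms by (simp add: ln_div)
  also have "\<dots> \<le> 1 / (q - 1)" using assms by (intro ln_add_one_self_le_self) auto
  finally show ?thesis .
qed

text \<open>With L = ln (q - 1) the loss is (q - 2) L / q, so r <= q - 2 reduces the claim to q (ln
  q - L) < 2 L. From q = 4 on the left side is below 2 <= 2 L; for q = 3 it amounts to 27 <
  32.\<close>

lemma gap_loss_below:
  fixes r P :: nat
  assumes "3 \<le> P" "r + 2 \<le> P"
  shows "r * gap P < 4 * loss P"
proof -
  define q where "q = real P"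
  define L where "L = ln (q - 1)"
  have q: "3 \<le> q" using assms unfolding q_def by simp
  have "q * (ln q - L) < 2 * L"
  proof (cases "P = 3")
    case True
    have "ln ((3::real) ^ 3) < ln (2 ^ 5)" by (subst ln_less_cancel_iff) simp_all
    then have "3 * ln (3::real) < 5 * ln 2"
      by (simp only: ln_realpow zero_less_numeral of_nat_numeral)
    then show ?thesis using True unfolding q_def L_def by simp
  next
    case False
    then have q4: "4 \<le> q" using assms unfolding q_def by simp
    have "q * (ln q - L) \<le> q * (1 / (q - 1))" unfolding L_def using q4 ln_diff_le[of q] by (intro mult_left_mono) auto
    also have "\<dots> < 2" using q4 by (simp add: field_simps)
    also have "2 \<le> 2 * L" unfolding L_def using q4 ln_ge_1[of "q - 1"] by simp
    finally show ?thesis .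
  qed
  then have "ln q - L < 2 * L / q" using q by (simp add: pos_less_divide_eq mult.commute)
  then have 1: "gap q < 4 * L / q" unfolding gap_eq L_def[symmetric] by simp
  have gap_nonneg: "0 \<le> gap q"
  proof -
    have "ln (q - 1) \<le> ln q" using q by simp
    then show ?thesis unfolding gap_eq using q by simp
  qed
  have "real r * gap q \<le> (q - 2) * gap q"
    using assms gap_nonneg unfolding q_def by (intro mult_right_mono) auto
  also have "\<dots> < (q - 2) * (4 * L / q)" using 1 q by (intro mult_strict_left_mono) auto
  also have "\<dots> = 4 * loss q" unfolding loss_def L_def[symmetric] using q by (simp add: field_simps)
  finally show ?thesis unfolding q_def .
qed

text \<open>For r = q - 1 and ln q - L <= 1 / (q - 1) the claim follows from q < (2q - 6) L; at q =
  5 this uses 3^5 < 4^4. At P = 4 the conclusion itself fails: 3 \<open>gap 4\<close> is about 2.51,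
  4 \<open>loss 4\<close> about 2.20.\<close>

lemma gap_loss_critical:
  fixes r P :: nat
  assumes "5 \<le> P" "P = r + 1"
  shows "r * gap P < 4 * loss P"
proof -
  define q where "q = real P"
  define L where "L = ln (q - 1)"
  have q: "5 \<le> q" "real r = q - 1" using assms unfolding q_def by auto
  have "q < (2 * q - 6) * L"
  proof (cases "P = 5")
    case True
    have "ln ((3::real) ^ 5) < ln (4 ^ 4)" by (subst ln_less_cancel_iff) simp_all
    then have "5 * ln (3::real) < 4 * ln 4"
      by (simp only: ln_realpow zero_less_numeral of_nat_numeral)
    then show ?thesis using True ln_ge_1[of 3] unfolding q_def L_def by simp
  next
    case False
    then have q6: "6 \<le> q" using assms unfolding q_def by simp
    have "ln 3 < L" unfolding L_def using q6 by simp
    then have L: "1 < L" using ln_ge_1[of 3] by linarith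
    have "q \<le> 2 * q - 6" using q6 by simp
    also have "\<dots> < (2 * q - 6) * L" using L q6 by simp
    finally show ?thesis .
  qed
  then have 1: "1 < (2 - 6 / q) * L" using q by (simp add: field_simps)
  have "(q - 1) * (ln q - L) \<le> (q - 1) * (1 / (q - 1))"
    unfolding L_def using q ln_diff_le[of q] by (intro mult_left_mono) auto
  then have "(q - 1) * (ln q - L) \<le> 1" using q by simp
  then have "real r * gap q \<le> 1 + (q - 1) * (2 / q) * L"
    unfolding gap_eq q(2) L_def[symmetric] by (simp add: algebra_simps)
  also have "\<dots> < (2 - 6 / q) * L + (q - 1) * (2 / q) * L" using 1 by simp
  also have "\<dots> = 4 * loss q" unfolding loss_def L_def[symmetric] using q by (simp add: field_simps)
  finally show ?thesis unfolding q_def .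
qed

text \<open>After multiplication by q the claim follows from r/2 + r/(2L) < q - 2 with L = ln (q -
  1). The threshold gives (q - 1)^2 >= r + 10, hence 2L >= ln (r + 10), so its second term pays for
  r/(2L).\<close>

lemma gap_loss_large:
  fixes r P :: nat
  assumes r: "1 \<le> r" and P: "real r / 2 + real r / ln (real r + 10) + 100 \<le> real P"
  shows "r * gap P < 4 * loss P"
proof -
  define q where "q = real P"
  define L where "L = ln (q - 1)"
  define l where "l = ln (real r + 10)"
  have l: "0 < l" unfolding l_def by simp
  have q: "real r / 2 + real r / l + 100 \<le> q" using P unfolding q_def l_def .
  have rl: "0 \<le> real r / l" using l by simp
  then have q1: "100 \<le> q" "real r / 2 + 99 \<le> q - 1" using q by linarith+
  have "real r + 10 \<le> (q - 1)\<^sup>2"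
  proof -
    have "(real r / 2 + 99)\<^sup>2 \<le> (q - 1)\<^sup>2" using q1 by (intro power_mono) auto
    moreover have "real r + 10 \<le> (real r / 2 + 99)\<^sup>2" by (simp add: power2_eq_square algebra_simps)
    ultimately show ?thesis by linarith
  qed
  then have "l \<le> ln ((q - 1)\<^sup>2)" unfolding l_def by (subst ln_le_cancel_iff) auto
  then have lL: "l \<le> 2 * L" unfolding L_def using q1 by (simp add: ln_realpow)
  then have L: "0 < L" using l by simp
  have "real r / (2 * L) \<le> real r / l" using lL l by (intro divide_left_mono) auto
  then have "real r / 2 + real r / (2 * L) < q - 2" using q by linarith
  then have "4 * L * (real r / 2 + real r / (2 * L)) < 4 * L * (q - 2)" using L by (intro mult_strict_left_mono) auto
  moreover have "4 * L * (real r / 2 + real r / (2 * L)) = 2 * r * L + 2 * r"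
    using L by (simp add: field_simps)
  ultimately have main: "2 * r * L + 2 * r < 4 * (q - 2) * L" by (simp add: mult_ac)
  have "real r * (q * (ln q - L)) \<le> real r * (q * (1 / (q - 1)))"
    unfolding L_def using q1 ln_diff_le[of q] by (intro mult_left_mono) auto
  also have "\<dots> \<le> real r * 2" using q1 by (intro mult_left_mono) (auto simp: field_simps)
  finally have "real r * (q * (ln q - L)) \<le> 2 * r" by simp
  moreover have "q * (real r * gap q) = real r * (q * (ln q - L)) + 2 * r * L"
    unfolding gap_eq L_def[symmetric] using q1 by (simp add: algebra_simps)
  moreover have "q * (4 * loss q) = 4 * (q - 2) * L"
    unfolding loss_def L_def[symmetric] using q1 by (simp add: algebra_simps)
  ultimately have "q * (real r * gap q) < q * (4 * loss q)" using main by linarith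
  then show ?thesis using q1 unfolding q_def by simp
qed

section \<open>The exceptional case of four ternary coordinates, and the structure for large
  sizes\<close>

context centered_pair
begin

text \<open>A vector of \<open>B\<close> that differs from \<open>x\<close> on all of
  \<open>supp x\<close> has already used up its \<open>card I - r\<close> disagreements, so
  elsewhere it equals \<open>x\<close>, that is \<open>z\<close>.\<close>

lemma card_le_full:
  assumes x: "x \<in> A" and full: "card (supp x) = card I - r"
  shows "card B \<le> (\<Prod>i\<in>supp x. p i - 1) + (\<Sum>i\<in>supp x. card {y\<in>B. y i = x i})"
proof -
  define F where "F = PiE I (\<lambda>i. if i \<in> supp x then {1..p i} - {x i} else {z i})"
  have xc: "x \<in> cube I p" using x subs by blast
  have "B \<subseteq> F \<union> (\<Union>i\<in>supp x. {y\<in>B. y i = x i})"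
  proof
    fix y assume y: "y \<in> B"
    show "y \<in> F \<union> (\<Union>i\<in>supp x. {y\<in>B. y i = x i})"
    proof (cases "\<exists>i\<in>supp x. y i = x i")
      case True then show ?thesis using y by blast
    next
      case False
      have "y j = z j" if j: "j \<in> I - supp x" for j
      proof (rule ccontr)
        assume "y j \<noteq> z j"
        then have "x j \<noteq> y j" using j unfolding supp_def by auto
        then have "{i\<in>I. x i = y i} \<subseteq> I - insert j (supp x)" using False by force
        then have "card {i\<in>I. x i = y i} \<le> card (I - insert j (supp x))"
          using finI by (intro card_mono) auto
        also have "\<dots> = card I - Suc (card I - r)"
          using j supp_subset finite_supp full by (subst card_Diff_subset) auto
        also have "\<dots> < r"
          using full j card_mono[OF finI, of "insert j (supp x)"] supp_subset[of x] finite_supp[of x] by simp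
        finally show False using x y cross unfolding cross_agree_def by force
      qed
      moreover have "y \<in> cube I p" using y subs by blast
      ultimately have "y \<in> F" using False unfolding F_def cube_def by (auto simp: PiE_iff)
      then show ?thesis by blast
    qed
  qed
  moreover have "finite F" unfolding F_def using finI by (intro finite_PiE) auto
  ultimately have "card B \<le> card (F \<union> (\<Union>i\<in>supp x. {y\<in>B. y i = x i}))"
    using fins finite_supp by (intro card_mono) auto
  also have "\<dots> \<le> card F + (\<Sum>i\<in>supp x. card {y\<in>B. y i = x i})"
    by (rule order_trans[OF card_Un_le add_left_mono[OF card_UN_le[OF finite_supp]]])
  also have "card F = (\<Prod>i\<in>I. if i \<in> supp x then p i - 1 else 1)"
    unfolding F_def using finI cube_mem[OF xc] by (auto simp: card_PiE intro!: prod.cong)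
  also have "\<dots> = (\<Prod>i\<in>I \<inter> supp x. p i - 1)" using finI by (rule prod.inter_restrict[symmetric])
  also have "I \<inter> supp x = supp x" using supp_subset by blast
  finally show ?thesis .
qed

text \<open>For \<open>p i = 3\<close> and \<open>card (supp x) = 3\<close> the bound of \<open>card_le_ball\<close> is void; the sharper rarity of single
  values is needed instead.\<close>

lemma ternary_card_le:
  assumes r: "r = 1" "card I = 4" and p: "\<And>i. i \<in> I \<Longrightarrow> p i = 3" and x: "x \<in> A"
  shows "card (supp x) = 1 \<Longrightarrow> card B \<le> 28" "card (supp x) = 2 \<Longrightarrow> card B \<le> 15"
    "card (supp x) = 3 \<Longrightarrow> card B \<le> 16"
proof -
  let ?J = "I - supp x"
  have cJ: "card ?J = 4 - card (supp x)" "finite ?J"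
    using r finI supp_subset finite_supp by (auto simp: card_Diff_subset)
  have es: "esym (\<lambda>i. p i - 1) ?J j = (card ?J choose j) * 2 ^ j" for j
    using cJ p by (intro esym_const) auto
  have cb: "card (ball ?J k) = (\<Sum>j\<le>k. (card ?J choose j) * 2 ^ j)" for k
    unfolding card_ball[OF Diff_subset] es ..
  have le: "3 * card B \<le> 3 * card (ball ?J (3 - card (supp x))) + card (supp x) * card B"
    using card_le_ball[OF x, of 3] p r by simp
  show "card B \<le> 28" if c: "card (supp x) = 1"
  proof -
    \<comment> \<open>19 = 1 + 3 * 2 + 3 * 4; then 2 |B| <= 57.\<close>
    have "card (ball ?J 2) = 19"
      using cJ c by (simp add: cb numeral_2_eq_2 numeral_3_eq_3)
    then show ?thesis using le c by simp
  qed
  show "card B \<le> 15" if c: "card (supp x) = 2"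
  proof -
    have "card (ball ?J 1) = 5" using cJ c by (simp add: cb)
    then show ?thesis using le c by simp
  qed
  show "card B \<le> 16" if c: "card (supp x) = 3"
  proof -
    have "(\<Prod>i\<in>supp x. p i - 1) = (\<Prod>i\<in>supp x. 2)"
      using p supp_subset[of x] by (intro prod.cong) auto
    then have "card B \<le> 8 + (\<Sum>i\<in>supp x. card {y\<in>B. y i = x i})"
      using card_le_full[OF x] c r by simp
    then have "6 * card B \<le> 48 + (\<Sum>i\<in>supp x. 6 * card {y\<in>B. y i = x i})"
      by (simp flip: sum_distrib_left)
    also have "(\<Sum>i\<in>supp x. 6 * card {y\<in>B. y i = x i}) \<le> (\<Sum>i\<in>supp x. card B)"
    proof (rule sum_mono)
      fix i assume "i \<in> supp x"
      then have i: "i \<in> I" "x i \<noteq> z i" unfolding supp_def by auto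
      have "real (6 * card {y\<in>B. y i = x i}) \<le> real (card B)"
        using rareB[OF i] p[OF i(1)] by simp
      then show "6 * card {y\<in>B. y i = x i} \<le> card B" by (simp only: of_nat_le_iff)
    qed
    finally show ?thesis using c by simp
  qed
qed

text \<open>Leaving three coordinates free gives |A||B| >= 27^2 = 729, while a + b > 3 allows at
  most 28 * 16 = 448.\<close>

lemma balls_if_ternary:
  assumes r: "r = 1" "card I = 4" and p: "\<And>i. i \<in> I \<Longrightarrow> p i = 3"
  obtains k where "k \<le> card I - r" "A = ball I k" "B = ball I (card I - r - k)"
proof (rule balls_if_supp_le)
  fix x y assume x: "x \<in> A" and y: "y \<in> B"
  define a b where "a = card (supp x)" and "b = card (supp y)"
  have small: "card I - r + 1 < p i * (p i - 1)" if "i \<in> I" for i using r p[OF that] by simp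
  have "a \<le> card I - r" "b \<le> card I - r" unfolding a_def b_def
    using card_supp_le[OF x small] centered_pair.card_supp_le[OF swap y small] by blast+
  then have ab: "a \<le> 3" "b \<le> 3" using r by auto
  have B: "a = 1 \<Longrightarrow> card B \<le> 28" "a = 2 \<Longrightarrow> card B \<le> 15" "a = 3 \<Longrightarrow> card B \<le> 16"
    unfolding a_def using ternary_card_le[OF r p x] by blast+
  have A: "b = 1 \<Longrightarrow> card A \<le> 28" "b = 2 \<Longrightarrow> card A \<le> 15" "b = 3 \<Longrightarrow> card A \<le> 16"
    unfolding b_def using centered_pair.ternary_card_le[OF swap r p y] by blast+
  obtain X where X: "X\<^sup>2 \<le> card A * card B"
    "\<And>U. U \<subseteq> I \<Longrightarrow> card U = card I - r \<Longrightarrow> (\<Prod>i\<in>U. p i) \<le> X" using max_prod[OF refl] by blast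
  obtain U where U: "U \<subseteq> I" "card U = card I - r" by (meson diff_le_self obtain_subset_with_card_n)
  have "(\<Prod>i\<in>U. p i) = (\<Prod>i\<in>U. 3)" using p U by (intro prod.cong) auto
  then have "27 \<le> X" using X(2)[OF U] U r by simp
  then have "27\<^sup>2 \<le> X\<^sup>2" by (intro power_mono) auto
  then have AB: "729 \<le> card A * card B" using X(1) by simp
  have "a + b \<le> 3"
  proof (rule ccontr)
    assume n: "\<not> a + b \<le> 3"
    have "card A * card B \<le> 448"
    proof (cases "a = 1 \<or> b = 1")
      case True
      then have "card A \<le> 28 \<and> card B \<le> 16 \<or> card A \<le> 16 \<and> card B \<le> 28" using n ab A B by fastforce
      then have "card A * card B \<le> 28 * 16 \<or> card A * card B \<le> 16 * 28" using mult_le_mono by blast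
      then show ?thesis by simp
    next
      case False
      then have "2 \<le> a" "2 \<le> b" using n ab by linarith+
      then have "a = 2 \<or> a = 3" "b = 2 \<or> b = 3" using ab by linarith+
      then have "card A \<le> 16" "card B \<le> 16" using A B by fastforce+
      then have "card A * card B \<le> 16 * 16" by (rule mult_le_mono)
      then show ?thesis by simp
    qed
    then show False using AB by simp
  qed
  then show "card (supp x) + card (supp y) \<le> card I - r" unfolding a_def b_def using r by simp
qed (use that in blast)

text \<open>If some size is at least 4, fixing another coordinate in \<open>sum_loss_le\<close>
  leads to 2 ln 2 <= ln 3. With all sizes 3 the inequality 3 \<open>loss 3\<close> <=
  \<open>gap 3\<close> is true, so entropy alone cannot exclude that configuration.\<close>

lemma ternary_if_excess_3:
  assumes r: "r = 1" "card I = 4" and i: "i \<in> I"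
  shows "p i = 3"
proof (rule ccontr)
  assume "p i \<noteq> 3"
  then have pi: "4 \<le> p i" using p3[OF i] by simp
  have "card (I - {i}) = 3" using r i by simp
  then have "I - {i} \<noteq> {}" by (metis card.empty zero_neq_numeral)
  then obtain j where j: "j \<in> I" "j \<noteq> i" by blast
  define K where "K = I - {i, j}"
  have K: "I - {j} = insert i K" "i \<notin> K" "finite K" "card K = 2"
    unfolding K_def using i j finI r by (auto simp: card_Diff_subset)
  have "(\<Sum>l\<in>I - {j}. loss (p l)) \<le> (\<Sum>l\<in>{j}. gap (p l))" using r j by (intro sum_loss_le) auto
  then have "loss (p i) + (\<Sum>l\<in>K. loss (p l)) \<le> gap (p j)" using K by simp
  moreover have "loss 4 \<le> loss (p i)" using pi by (intro loss_mono) auto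
  moreover have "(\<Sum>l\<in>K. loss 3) \<le> (\<Sum>l\<in>K. loss (p l))"
    using p3 unfolding K_def by (intro sum_mono loss_mono) auto
  moreover have "gap (p j) \<le> gap 3" using gap_antimono[of 3 "p j"] p3[OF j(1)] by simp
  ultimately have "loss 4 + 2 * loss 3 \<le> gap 3" using K by simp
  moreover have "ln ((3::real) ^ 1) < ln (2 ^ 2)" by (subst ln_less_cancel_iff) simp_all
  then have "ln (3::real) < 2 * ln 2" by (simp only: ln_realpow zero_less_numeral of_nat_numeral power_one_right)
  ultimately show False unfolding gap_def loss_def by simp
qed

lemma excess_le_3:
  assumes "3 \<le> P" "\<And>i. i \<in> I \<Longrightarrow> P \<le> p i" and "r * gap P < 4 * loss P"
  shows "card I - r \<le> 3"
proof -
  have "real (card I - r) * loss P \<le> r * gap P" by (rule loss_gap_min) (use assms in auto)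
  then have "real (card I - r) * loss P < 4 * loss P" using assms(3) by linarith
  moreover have "0 < loss P" using assms(1) by (intro loss_pos) simp
  ultimately have "real (card I - r) < 4" by simp
  then show ?thesis by simp
qed

lemma structure_if_large:
  assumes r: "1 \<le> r" and P: "3 \<le> P" "\<And>i. i \<in> I \<Longrightarrow> P \<le> p i"
    and large: "r + 2 \<le> P \<or> P = r + 1 \<and> 5 \<le> P"
  shows "card I = r \<and> A = ball I 0 \<and> B = ball I 0 \<or>
    card I = r + 2 \<and> P = r + 1 \<and> (\<forall>i\<in>I. p i = r + 1) \<and> A = ball I 1 \<and> B = ball I 1"
proof -
  define s where "s = card I - r"
  have "r * gap P < 4 * loss P"
    using large gap_loss_below[OF P(1)] gap_loss_critical[of P r] by blast
  then have s: "s \<le> 3" unfolding s_def using excess_le_3[OF P] by blast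
  have m: "card I = r + s" unfolding s_def using rle by simp
  obtain k where k: "k \<le> s" "A = ball I k" "B = ball I (s - k)"
  proof (cases "s \<le> 2 \<or> 4 \<le> P")
    case True
    have "6 \<le> P * (P - 1)" using mult_le_mono[of 3 P 2 "P - 1"] P(1) by simp
    then have "s + 1 < P * (P - 1)" using s by linarith
    moreover have "card I + 1 \<le> P + s" using m large by linarith
    ultimately show ?thesis
      using balls_if_vol_small[OF s_def P(2) _ vol_small_close[OF P(1) s True]] that
      unfolding s_def by blast
  next
    case False
    \<comment> \<open>P = 3 is compatible only with r + 2 <= P, so r = 1.\<close>
    then have "s = 3" "r = 1" "card I = 4" using s P(1) large m r by linarith+
    then show ?thesis using balls_if_ternary ternary_if_excess_3 that unfolding s_def by metis
  qed
  have "card I = r \<and> A = {z} \<and> B = {z} \<or>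
      card I = r + 2 \<and> (\<forall>i\<in>I. p i = r + 1) \<and> A = ball I 1 \<and> B = ball I 1"
  proof (rule balls_structure[OF k(2,3,1) s_def])
    fix i assume "i \<in> I"
    then have "P \<le> p i" by (rule P(2))
    then show "r + 1 \<le> p i" "card I + 2 \<le> 2 * p i" using large P(1) m s by linarith+
  qed
  then show ?thesis
  proof
    assume *: "card I = r + 2 \<and> (\<forall>i\<in>I. p i = r + 1) \<and> A = ball I 1 \<and> B = ball I 1"
    then have "I \<noteq> {}" by auto
    then have "P \<le> r + 1" using P(2) * by (metis all_not_in_conv)
    then show ?thesis using * large by auto
  qed (use ball_0 in auto)
qed

end

lemma max_cross_reduce_centered:
  assumes mx: "max_cross I p r A B" and I: "finite I" "r \<le> card I" "\<forall>i\<in>I. 3 \<le> p i"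
  obtains T A' B' z where "T \<subseteq> I" "centered_pair T p r A' B' z"
    "A = {x \<in> cube I p. restrict x T \<in> A'}" "B = {x \<in> cube I p. restrict x T \<in> B'}"
    "card A = (\<Prod>i\<in>I - T. p i) * card A'" "card B = (\<Prod>i\<in>I - T. p i) * card B'"
proof -
  have "\<forall>i\<in>I. 2 \<le> p i" using I(3) by force
  from max_cross_reduce[OF mx I(1,2) this] obtain T A' B' where T: "T \<subseteq> I" "r \<le> card T"
    "max_cross T p r A' B'" "\<forall>i\<in>T. \<not> irrelevant p A' i \<and> \<not> irrelevant p B' i"
    and eq: "A = {x \<in> cube I p. restrict x T \<in> A'}" "B = {x \<in> cube I p. restrict x T \<in> B'}"
    "card A = (\<Prod>i\<in>I - T. p i) * card A'" "card B = (\<Prod>i\<in>I - T. p i) * card B'" by auto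
  have "finite T" "\<forall>i\<in>T. 3 \<le> p i" using T(1) I finite_subset by auto
  then obtain z where "centered_pair T p r A' B' z" using centered_pair_exists[OF T(3) _ T(2) _ T(4)] by blast
  then show ?thesis using that T(1) eq by blast
qed

section \<open>The three cases\<close>

lemma Sp_eq_cube: "Sp n p = cube {1..n} p"
  unfolding Sp_def cube_def ..

lemma cross_intersecting_iff: "cross_intersecting n p r A B \<longleftrightarrow> cross_agree {1..n} p r A B"
  unfolding cross_intersecting_def cross_agree_def r_intersecting_def Sp_eq_cube ..

lemma maximal_pair_iff: "maximal_pair n p r A B \<longleftrightarrow> max_cross {1..n} p r A B"
  unfolding maximal_pair_def max_cross_def cross_intersecting_iff ..

lemma hamming_ball_eq:
  assumes cp: "centered_pair T p r A B z" and T: "T \<subseteq> {1..n}" and p: "\<forall>i\<in>{1..n}. 1 \<le> p i"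
  obtains x0 where "x0 \<in> Sp n p"
    "\<forall>k. {x \<in> cube {1..n} p. restrict x T \<in> centered_pair.ball T p z T k} = hamming_ball n p T x0 k"
proof -
  interpret centered_pair T p r A B z by (rule cp)
  \<comment> \<open>The value 1 outside \<open>T\<close> is a filler that puts the centre into
    \<open>Sp n p\<close>.\<close>
  define x0 where "x0 = restrict (\<lambda>i. if i \<in> T then z i else 1) {1..n}"
  have mem: "x0 \<in> Sp n p" unfolding Sp_def x0_def using p z_mem by auto
  have "restrict x T \<in> ball T k \<longleftrightarrow> card {i\<in>T. x i \<noteq> x0 i} \<le> k" if x: "x \<in> cube {1..n} p" for x k
  proof -
    have "x i \<in> {1..p i}" if "i \<in> T" for i by (rule cube_mem[OF x subsetD[OF T that]])
    then have "restrict x T \<in> cube T p" unfolding cube_def by (simp add: restrict_PiE_iff)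
    moreover have "supp (restrict x T) = {i\<in>T. x i \<noteq> x0 i}"
      unfolding supp_def x0_def using T by auto
    ultimately show ?thesis unfolding ball_def by auto
  qed
  then have "{x \<in> cube {1..n} p. restrict x T \<in> ball T k} = hamming_ball n p T x0 k" for k
    unfolding hamming_ball_def Sp_eq_cube by blast
  then show ?thesis by (intro that[OF mem]) blast
qed

text \<open>The two index sets have the same size. Where they differ, the left one uses indices up
  to r, with sizes at most \<open>p r\<close>, and the right one indices above r, with sizes at
  least \<open>p r\<close>.\<close>

lemma prod_sorted_le:
  assumes sorted: "sorted_sizes n p" and r: "1 \<le> r" "r \<le> n" and T: "T \<subseteq> {1..n}" "card T = r"
  shows "(\<Prod>i\<in>{1..n} - T. p i) \<le> (\<Prod>i\<in>{r+1..n}. p i)"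
proof -
  define U W where "U = {1..n} - T" and "W = {r+1..n}"
  have fin: "finite U" "finite W" unfolding U_def W_def by auto
  have cU: "card U = n - r" unfolding U_def using T by (simp add: card_Diff_subset finite_subset)
  have "card U = card (U \<inter> W) + card (U - W)" "card W = card (U \<inter> W) + card (W - U)"
    using fin by (simp_all add: card_Int_Diff Int_commute) (metis Int_commute card_Int_Diff)
  then have c: "card (U - W) = card (W - U)" using cU unfolding W_def by simp
  have "(\<Prod>i\<in>U - W. p i) \<le> (\<Prod>i\<in>U - W. p r)"
    using sorted r unfolding sorted_sizes_def U_def W_def by (intro prod_mono) auto
  also have "\<dots> = (\<Prod>i\<in>W - U. p r)" using c by simp
  also have "\<dots> \<le> (\<Prod>i\<in>W - U. p i)"
    using sorted r unfolding sorted_sizes_def U_def W_def by (intro prod_mono) auto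
  finally have "(\<Prod>i\<in>U \<inter> W. p i) * (\<Prod>i\<in>U - W. p i) \<le> (\<Prod>i\<in>U \<inter> W. p i) * (\<Prod>i\<in>W - U. p i)"
    by (rule mult_le_mono2)
  moreover have "(\<Prod>i\<in>U. p i) = (\<Prod>i\<in>U \<inter> W. p i) * (\<Prod>i\<in>U - W. p i)"
    using fin by (rule_tac prod.Int_Diff)
  moreover have "(\<Prod>i\<in>W. p i) = (\<Prod>i\<in>U \<inter> W. p i) * (\<Prod>i\<in>W - U. p i)"
    using fin prod.Int_Diff[of W p U] by (simp add: Int_commute)
  ultimately show ?thesis unfolding U_def W_def by simp
qed

lemma max_cross_large:
  assumes r: "1 \<le> r" "r \<le> n" and sorted: "sorted_sizes n p"
    and large: "r + 2 \<le> p 1 \<or> p 1 = r + 1 \<and> 5 \<le> p 1" and mx: "max_cross {1..n} p r A B"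
  shows "card A * card B \<le> (\<Prod>i\<in>{r+1..n}. p i ^ 2)" and "A = B"
    and "fixes_r_coords n p r A \<or> p 1 = r + 1 \<and>
      (\<exists>T x0. T \<subseteq> {1..n} \<and> card T = r + 2 \<and> (\<forall>i\<in>T. p i = r + 1) \<and>
        x0 \<in> Sp n p \<and> A = hamming_ball n p T x0 1)"
proof -
  have P: "3 \<le> p 1" using r large by auto
  have ge: "p 1 \<le> p i" if "i \<in> {1..n}" for i
    using sorted that unfolding sorted_sizes_def by auto
  have p1: "\<forall>i\<in>{1..n}. 1 \<le> p i" and p3: "\<forall>i\<in>{1..n}. 3 \<le> p i" using ge P by force+
  have le: "r \<le> card {1..n}" using r by simp
  obtain T A' B' z where T: "T \<subseteq> {1..n}" and cp: "centered_pair T p r A' B' z"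
    and eq: "A = {x \<in> cube {1..n} p. restrict x T \<in> A'}" "B = {x \<in> cube {1..n} p. restrict x T \<in> B'}"
    and cards: "card A = (\<Prod>i\<in>{1..n} - T. p i) * card A'" "card B = (\<Prod>i\<in>{1..n} - T. p i) * card B'"
    by (rule max_cross_reduce_centered[OF mx finite_atLeastAtMost le p3])
  interpret centered_pair T p r A' B' z by (rule cp)
  obtain x0 where x0: "x0 \<in> Sp n p"
    "\<forall>k. {x \<in> cube {1..n} p. restrict x T \<in> ball T k} = hamming_ball n p T x0 k"
    by (rule hamming_ball_eq[OF cp T p1])
  have bound: "(\<Prod>i\<in>{1..n} - R. p i)\<^sup>2 \<le> (\<Prod>i\<in>{r+1..n}. p i ^ 2)" if "R \<subseteq> {1..n}" "card R = r" for R
    unfolding prod_power_distrib[symmetric] using prod_sorted_le[OF sorted r that] by (intro power_mono) auto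
  have "card T = r \<and> A' = ball T 0 \<and> B' = ball T 0 \<or>
      card T = r + 2 \<and> p 1 = r + 1 \<and> (\<forall>i\<in>T. p i = r + 1) \<and> A' = ball T 1 \<and> B' = ball T 1"
    using structure_if_large[OF r(1) P _ large] ge T by blast
  then have "card A * card B \<le> (\<Prod>i\<in>{r+1..n}. p i ^ 2) \<and> A = B \<and>
    (fixes_r_coords n p r A \<or> p 1 = r + 1 \<and>
      (\<exists>T x0. T \<subseteq> {1..n} \<and> card T = r + 2 \<and> (\<forall>i\<in>T. p i = r + 1) \<and>
        x0 \<in> Sp n p \<and> A = hamming_ball n p T x0 1))"
  proof (elim disjE conjE)
    assume c: "card T = r" "A' = ball T 0" "B' = ball T 0"
    have "card A * card B = (\<Prod>i\<in>{1..n} - T. p i)\<^sup>2"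
      unfolding cards c ball_0 by (simp add: power2_eq_square)
    moreover have "A = {x \<in> Sp n p. \<forall>i\<in>T. x i = x0 i}"
      unfolding eq(1) c x0(2)[rule_format] hamming_ball_def using finI by auto
    then have "fixes_r_coords n p r A"
      using T c(1) x0(1) unfolding fixes_r_coords_def Sp_eq_cube
      by (intro exI[of _ T] exI[of _ x0]) (auto dest: cube_mem)
    ultimately show ?thesis using bound[OF T c(1)] eq c by simp
  next
    assume c: "card T = r + 2" "p 1 = r + 1" "\<forall>i\<in>T. p i = r + 1" "A' = ball T 1" "B' = ball T 1"
    \<comment> \<open>Such a ball has 1 + (r + 2) r = (r + 1)^2 members on \<open>T\<close>, exactly
      as many as a subcube of \<open>cube T p\<close> fixing r coordinates. So the bound for
      subcubes applies to it too.\<close>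
    have "(\<Sum>i\<in>T. p i - 1) = (r + 2) * r" using c by simp
    then have cb: "card (ball T 1) = (r + 1) * (r + 1)" unfolding card_ball_1 by simp
    obtain R where R: "R \<subseteq> T" "card R = r" using rle obtain_subset_with_card_n by metis
    have "(\<Prod>i\<in>T - R. p i) = (\<Prod>i\<in>T - R. r + 1)" using c(3) by (intro prod.cong) auto
    also have "\<dots> = (r + 1) * (r + 1)"
      using R c(1) finI by (simp add: card_Diff_subset finite_subset power2_eq_square)
    finally have TR: "(\<Prod>i\<in>T - R. p i) = (r + 1) * (r + 1)" .
    have "T - R \<subseteq> {1..n} - R" "{1..n} - R - (T - R) = {1..n} - T" using T R(1) by auto
    then have "(\<Prod>i\<in>{1..n} - T. p i) * ((r + 1) * (r + 1)) = (\<Prod>i\<in>{1..n} - R. p i)"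
      using prod.subset_diff[of "T - R" "{1..n} - R" p] TR by simp
    then have "card A * card B = (\<Prod>i\<in>{1..n} - R. p i)\<^sup>2"
      unfolding cards c(4,5) cb by (simp only: power2_eq_square)
    moreover have "R \<subseteq> {1..n}" using R T by blast
    ultimately have "card A * card B \<le> (\<Prod>i\<in>{r+1..n}. p i ^ 2)" using bound R(2) by simp
    moreover have "A = hamming_ball n p T x0 1" unfolding eq(1) c x0(2)[rule_format] ..
    moreover have "A = B" unfolding eq c ..
    ultimately show ?thesis using T c(1-3) x0(1) by blast
  qed
  then show "card A * card B \<le> (\<Prod>i\<in>{r+1..n}. p i ^ 2)" "A = B"
    "fixes_r_coords n p r A \<or> p 1 = r + 1 \<and>
      (\<exists>T x0. T \<subseteq> {1..n} \<and> card T = r + 2 \<and> (\<forall>i\<in>T. p i = r + 1) \<and>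
        x0 \<in> Sp n p \<and> A = hamming_ball n p T x0 1)" by blast+
qed

text \<open>The bound holds for every pair because it holds for a maximal one; a pair attaining it
  is therefore maximal itself and inherits the structure.\<close>

lemma cross_large:
  assumes r: "1 \<le> r" "r \<le> n" and sorted: "sorted_sizes n p"
    and large: "r + 2 \<le> p 1 \<or> p 1 = r + 1 \<and> 5 \<le> p 1" and cr: "cross_intersecting n p r A B"
  shows "card A * card B \<le> (\<Prod>i\<in>{r+1..n}. p i ^ 2)"
    and "card A * card B = (\<Prod>i\<in>{r+1..n}. p i ^ 2) \<Longrightarrow> maximal_pair n p r A B"
proof -
  obtain A0 B0 where mx: "max_cross {1..n} p r A0 B0" using max_cross_exists[of "{1..n}" p r] by blast
  have 0: "card A' * card B' \<le> (\<Prod>i\<in>{r+1..n}. p i ^ 2)" if "cross_agree {1..n} p r A' B'" for A' B'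
  proof -
    have "card A' * card B' \<le> card A0 * card B0" using mx that unfolding max_cross_def by blast
    then show ?thesis using max_cross_large(1)[OF r sorted large mx] by linarith
  qed
  show "card A * card B \<le> (\<Prod>i\<in>{r+1..n}. p i ^ 2)" using 0 cr unfolding cross_intersecting_iff by blast
  assume "card A * card B = (\<Prod>i\<in>{r+1..n}. p i ^ 2)"
  then show "maximal_pair n p r A B"
    using cr 0 unfolding maximal_pair_iff max_cross_def cross_intersecting_iff by simp
qed

lemma maximal_pair_balls:
  assumes r: "1 \<le> r" "r \<le> n" and sorted: "sorted_sizes n p"
    and P: "real r / 2 + real r / ln (real r + 10) + 100 \<le> real (p 1)"
    and mx: "max_cross {1..n} p r A B"
  shows "\<exists>T x0 k l. T \<subseteq> {1..n} \<and> card T \<le> r + 3 \<and> x0 \<in> Sp n p \<and> k \<le> card T \<and> l \<le> card T \<and>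
    A = hamming_ball n p T x0 k \<and> B = hamming_ball n p T x0 l"
proof -
  have "0 \<le> real r / ln (real r + 10)" by simp
  then have "real r / 2 + 100 \<le> real (p 1)" using P by linarith
  then have P1: "100 \<le> p 1" "r \<le> 2 * p 1" by linarith+
  have ge: "p 1 \<le> p i" if "i \<in> {1..n}" for i
    using sorted that unfolding sorted_sizes_def by auto
  have p1: "\<forall>i\<in>{1..n}. 1 \<le> p i" and p3: "\<forall>i\<in>{1..n}. 3 \<le> p i" using ge P1 by force+
  have le: "r \<le> card {1..n}" using r by simp
  obtain T A' B' z where T: "T \<subseteq> {1..n}" and cp: "centered_pair T p r A' B' z"
    and eq: "A = {x \<in> cube {1..n} p. restrict x T \<in> A'}" "B = {x \<in> cube {1..n} p. restrict x T \<in> B'}"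
    and "card A = (\<Prod>i\<in>{1..n} - T. p i) * card A'" "card B = (\<Prod>i\<in>{1..n} - T. p i) * card B'"
    by (rule max_cross_reduce_centered[OF mx finite_atLeastAtMost le p3])
  interpret centered_pair T p r A' B' z by (rule cp)
  obtain x0 where x0: "x0 \<in> Sp n p"
    "\<forall>k. {x \<in> cube {1..n} p. restrict x T \<in> ball T k} = hamming_ball n p T x0 k"
    by (rule hamming_ball_eq[OF cp T p1])
  define s where "s = card T - r"
  have geT: "p 1 \<le> p i" if "i \<in> T" for i using ge T that by blast
  have "3 \<le> p 1" using P1 by simp
  then have s: "s \<le> 3"
    unfolding s_def using excess_le_3[OF _ geT gap_loss_large[OF r(1) P]] by blast
  have m: "card T = r + s" unfolding s_def using rle by simp
  have "100 * 99 \<le> p 1 * (p 1 - 1)" using P1 by (intro mult_le_mono) auto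
  then have "s + 1 < p 1 * (p 1 - 1)" using s by linarith
  moreover have "card T \<le> 3 * p 1" "10 \<le> p 1" using m s P1 by linarith+
  ultimately obtain k where k: "k \<le> s" "A' = ball T k" "B' = ball T (s - k)"
    using balls_if_vol_small[OF s_def geT _ vol_small_large[OF _ s]] unfolding s_def by blast
  have "A = hamming_ball n p T x0 k" "B = hamming_ball n p T x0 (s - k)"
    unfolding eq k x0(2)[rule_format] by blast+
  moreover have "card T \<le> r + 3" "k \<le> card T" "s - k \<le> card T" using m s k(1) by linarith+
  ultimately show ?thesis using T x0(1) by blast
qed

theorem theorem7:
  shows
   "(\<forall>n r p A B. 1 \<le> r \<and> r \<le> n \<and> size_vector n p \<and> sorted_sizes n p \<and>
        cross_intersecting n p r A B \<and> p 1 > r + 1 \<longrightarrow>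
        card A * card B \<le> (\<Prod>i\<in>{r+1..n}. p i ^ 2) \<and>
        (card A * card B = (\<Prod>i\<in>{r+1..n}. p i ^ 2) \<longrightarrow>
           A = B \<and> fixes_r_coords n p r A))
  \<and> (\<forall>n r p A B. 1 \<le> r \<and> r \<le> n \<and> size_vector n p \<and> sorted_sizes n p \<and>
        cross_intersecting n p r A B \<and> p 1 = r + 1 \<and> r + 1 > 4 \<longrightarrow>
        card A * card B \<le> (\<Prod>i\<in>{r+1..n}. p i ^ 2) \<and>
        (card A * card B = (\<Prod>i\<in>{r+1..n}. p i ^ 2) \<longrightarrow>
           A = B \<and>
           (fixes_r_coords n p r A \<or>
            (\<exists>T x0. T \<subseteq> {1..n} \<and> card T = r + 2 \<and> (\<forall>i\<in>T. p i = r + 1) \<and>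
                    x0 \<in> Sp n p \<and> A = hamming_ball n p T x0 1))))
  \<and> (\<exists>t :: nat \<Rightarrow> real. (\<lambda>r. t r - real r / 2) \<in> o(\<lambda>r. real r) \<and>
       (\<forall>n r p A B. 1 \<le> r \<and> r \<le> n \<and> size_vector n p \<and> sorted_sizes n p \<and>
          real (p 1) \<ge> t r \<and> maximal_pair n p r A B \<longrightarrow>
          (\<exists>T x0 k l. T \<subseteq> {1..n} \<and> card T \<le> r + 3 \<and> x0 \<in> Sp n p \<and>
             k \<le> card T \<and> l \<le> card T \<and>
             A = hamming_ball n p T x0 k \<and> B = hamming_ball n p T x0 l)))"
proof (intro conjI allI impI)
  fix n r p A B
  assume "1 \<le> r \<and> r \<le> n \<and> size_vector n p \<and> sorted_sizes n p \<and>
      cross_intersecting n p r A B \<and> p 1 > r + 1"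
  then have r: "1 \<le> r" "r \<le> n" "sorted_sizes n p" and large: "r + 2 \<le> p 1 \<or> p 1 = r + 1 \<and> 5 \<le> p 1"
    and cr: "cross_intersecting n p r A B" and p1: "p 1 \<noteq> r + 1" by auto
  show "card A * card B \<le> (\<Prod>i\<in>{r+1..n}. p i ^ 2)" by (rule cross_large(1)[OF r large cr])
  assume "card A * card B = (\<Prod>i\<in>{r+1..n}. p i ^ 2)"
  then have mx: "max_cross {1..n} p r A B"
    using cross_large(2)[OF r large cr] unfolding maximal_pair_iff by blast
  show "A = B" "fixes_r_coords n p r A"
    using max_cross_large(2,3)[OF r large mx] p1 by blast+
next
  fix n r p A B
  assume "1 \<le> r \<and> r \<le> n \<and> size_vector n p \<and> sorted_sizes n p \<and>
      cross_intersecting n p r A B \<and> p 1 = r + 1 \<and> r + 1 > 4"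
  then have r: "1 \<le> r" "r \<le> n" "sorted_sizes n p" and large: "r + 2 \<le> p 1 \<or> p 1 = r + 1 \<and> 5 \<le> p 1"
    and cr: "cross_intersecting n p r A B" by auto
  show "card A * card B \<le> (\<Prod>i\<in>{r+1..n}. p i ^ 2)" by (rule cross_large(1)[OF r large cr])
  assume "card A * card B = (\<Prod>i\<in>{r+1..n}. p i ^ 2)"
  then have mx: "max_cross {1..n} p r A B"
    using cross_large(2)[OF r large cr] unfolding maximal_pair_iff by blast
  show "A = B" "fixes_r_coords n p r A \<or>
      (\<exists>T x0. T \<subseteq> {1..n} \<and> card T = r + 2 \<and> (\<forall>i\<in>T. p i = r + 1) \<and>
        x0 \<in> Sp n p \<and> A = hamming_ball n p T x0 1)"
    using max_cross_large(2,3)[OF r large mx] by blast+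
next
  \<comment> \<open>r/2 is the point where 2r/P falls to 4. The logarithmic term, of order o(r),
    absorbs the error in \<open>gap\<close>; 10 keeps the logarithm positive at every r, and 100
    leaves room for the volume estimates.\<close>
  define t :: "nat \<Rightarrow> real" where "t r = real r / 2 + real r / ln (real r + 10) + 100" for r
  have "(\<lambda>r. t r - real r / 2) \<in> o(\<lambda>r. real r)" unfolding t_def by real_asymp
  moreover have "\<forall>n r p A B. 1 \<le> r \<and> r \<le> n \<and> size_vector n p \<and> sorted_sizes n p \<and>
          real (p 1) \<ge> t r \<and> maximal_pair n p r A B \<longrightarrow>
          (\<exists>T x0 k l. T \<subseteq> {1..n} \<and> card T \<le> r + 3 \<and> x0 \<in> Sp n p \<and>
             k \<le> card T \<and> l \<le> card T \<and>
             A = hamming_ball n p T x0 k \<and> B = hamming_ball n p T x0 l)"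
    using maximal_pair_balls unfolding maximal_pair_iff t_def by simp
  ultimately show "\<exists>t :: nat \<Rightarrow> real. (\<lambda>r. t r - real r / 2) \<in> o(\<lambda>r. real r) \<and>
       (\<forall>n r p A B. 1 \<le> r \<and> r \<le> n \<and> size_vector n p \<and> sorted_sizes n p \<and>
          real (p 1) \<ge> t r \<and> maximal_pair n p r A B \<longrightarrow>
          (\<exists>T x0 k l. T \<subseteq> {1..n} \<and> card T \<le> r + 3 \<and> x0 \<in> Sp n p \<and>
             k \<le> card T \<and> l \<le> card T \<and>
             A = hamming_ball n p T x0 k \<and> B = hamming_ball n p T x0 l))"
    by blast
qed

end
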